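(* Let $\delta>0$ and $\beta\in[0,d+p)$. Then there exists a constant $C$, independent of $\delta$ and $\beta$, such that for every $u\in\mathcal{S}^{\beta}_\delta(\mathcal{R}_{-\delta}^{\infty})$, $$\frac1\delta\|u\|^p_{L^p(\mathcal{R}_{-\delta})}\le C|d+p-\beta|^{-1}\|u\|^{p-1}_{L^p(\mathcal{R}_{-\delta}^\infty)}|u|_{\mathcal{S}^{\beta}_\delta(\mathcal{R}_{-\delta}^\infty)}\le C|d+p-\beta|^{-1}\left(\|u\|^p_{L^p(\mathcal{R}_{-\delta}^\infty)}+|u|^p_{\mathcal{S}^{\beta}_\delta(\mathcal{R}_{-\delta}^\infty)}\right),$$ $$|u|^p_{\mathcal{T}^{\beta}_\delta(\mathcal{R}_{-\delta})}\le C|d+p-\beta|^{-1}|u|^p_{\mathcal{S}^{\beta}_\delta(\mathcal{R}_{-\delta}^\infty)},$$ and therefore $$\|u\|_{\mathcal{T}^{\beta}_\delta(\mathcal{R}_{-\delta})}\le C|d+p-\beta|^{-1/p}\|u\|_{\mathcal{S}^{\beta}_\delta(\mathcal{R}_{-\delta}^\infty)}.$$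
   Context: Here $d$ is a positive integer and $1<p<\infty$. Notation: $\mathcal{R}_{-\delta}=(-\delta,0)\times\mathbb{R}^{d-1}$ and $\mathcal{R}_{-\delta}^\infty=(-\delta,\infty)\times\mathbb{R}^{d-1}$. For $\delta>0$ and $\beta\in[0,d+p)$ the kernel is $\gamma^{\beta}_\delta(r)=\frac{C_{d,p,\beta}}{\delta^{d+p-\beta}}\,r^{-\beta}\,1_{\{r<\delta\}}$ with $C_{d,p,\beta}=(d+p-\beta)/s_{d-1}$, where $s_{d-1}$ is the surface area of the unit sphere in $\mathbb{R}^d$. For a domain $U\subset\mathbb{R}^d$, $|u|^p_{\mathcal{S}^{\beta}_\delta(U)}=\int_U\int_U\gamma^\beta_\delta(|y-x|)\,|u(y)-u(x)|^p\,dy\,dx$ and $\|u\|_{\mathcal{S}^\beta_\delta(U)}=(\|u\|_{L^p(U)}^p+|u|^p_{\mathcal{S}^\beta_\delta(U)})^{1/p}$; the space $\mathcal{S}^\beta_\delta(U)$ is the completion, with respect to this norm, of the functions in $C^1(\overline U)$ with finite norm. For measurable $V\subset\mathbb{R}^d$, $\mathcal{T}^\beta_\delta(V)$ is the space of $u\in L^p(V)$ with finite norm $\|u\|_{\mathcal{T}^\beta_\delta(V)}=\left(\frac1\delta\|u\|^p_{L^p(V)}+|u|^p_{\mathcal{T}^\beta_\delta(V)}\right)^{1/p}$, where $$|u|^p_{\mathcal{T}^\beta_\delta(V)}=\delta^{\beta-2}\int_V\int_V\frac{|u(y)-u(x)|^p}{(|y-x|\vee\delta)^{d+p-2}(|y-x|\wedge\delta)^\beta}\,dy\,dx,$$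 with $a\vee b=\max(a,b)$, $a\wedge b=\min(a,b)$. *)

theory Defs
  imports "HOL-Analysis.Analysis"
begin

text \<open>
  The \<open>p\<close>-th powers of norms and seminorms are taken in \<^typ>\<open>ennreal\<close>, so that they may be
  infinite; the real-valued norms below are meaningful only where these powers are finite, which
  is part of membership in the function spaces.
\<close>

definition Lp_pow :: "real \<Rightarrow> 'a::euclidean_space set \<Rightarrow> ('a \<Rightarrow> real) \<Rightarrow> ennreal" where
  "Lp_pow p U u = (\<integral>\<^sup>+x. ennreal (\<bar>u x\<bar> powr p) \<partial>lebesgue_on U)"

definition Lp_norm :: "real \<Rightarrow> 'a::euclidean_space set \<Rightarrow> ('a \<Rightarrow> real) \<Rightarrow> real" where
  "Lp_norm p U u = enn2real (Lp_pow p U u) powr (1 / p)"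

text \<open>
  Surface area of the unit sphere in \<open>d\<close>-dimensional space, which is \<open>d\<close> times the volume of the
  unit ball (for \<open>d = 1\<close> this is the number of points of the sphere, namely 2).
\<close>

definition sphere_area :: "nat \<Rightarrow> real" where
  "sphere_area d = real d * unit_ball_vol (real d)"

text \<open>
  At \<open>r = 0\<close> the kernel takes the value 0 instead of being singular (\<^term>\<open>0 powr a = (0::real)\<close>
  for every \<open>a\<close>); in the double integrals this concerns only the diagonal, where the difference
  \<open>u y - u x\<close> vanishes anyway.
\<close>

definition kernel :: "nat \<Rightarrow> real \<Rightarrow> real \<Rightarrow> real \<Rightarrow> real \<Rightarrow> real" where
  "kernel d p \<delta> \<beta> r =
     ((real d + p - \<beta>) / sphere_area d) / \<delta> powr (real d + p - \<beta>)
       * r powr (- \<beta>) * (if r < \<delta> then 1 else 0)"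

definition S_semi_pow ::
    "real \<Rightarrow> real \<Rightarrow> real \<Rightarrow> 'a::euclidean_space set \<Rightarrow> ('a \<Rightarrow> real) \<Rightarrow> ennreal" where
  "S_semi_pow p \<delta> \<beta> U u =
     (\<integral>\<^sup>+x. (\<integral>\<^sup>+y. ennreal (kernel DIM('a) p \<delta> \<beta> (norm (y - x)) * \<bar>u y - u x\<bar> powr p)
        \<partial>lebesgue_on U) \<partial>lebesgue_on U)"

definition S_semi ::
    "real \<Rightarrow> real \<Rightarrow> real \<Rightarrow> 'a::euclidean_space set \<Rightarrow> ('a \<Rightarrow> real) \<Rightarrow> real" where
  "S_semi p \<delta> \<beta> U u = enn2real (S_semi_pow p \<delta> \<beta> U u) powr (1 / p)"

definition S_norm ::
    "real \<Rightarrow> real \<Rightarrow> real \<Rightarrow> 'a::euclidean_space set \<Rightarrow> ('a \<Rightarrow> real) \<Rightarrow> real" where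
  "S_norm p \<delta> \<beta> U u = (Lp_norm p U u powr p + S_semi p \<delta> \<beta> U u powr p) powr (1 / p)"

definition S_finite ::
    "real \<Rightarrow> real \<Rightarrow> real \<Rightarrow> 'a::euclidean_space set \<Rightarrow> ('a \<Rightarrow> real) \<Rightarrow> bool" where
  "S_finite p \<delta> \<beta> U u \<longleftrightarrow>
     u \<in> borel_measurable (lebesgue_on U) \<and> Lp_pow p U u < \<infinity> \<and> S_semi_pow p \<delta> \<beta> U u < \<infinity>"

text \<open>
  Functions on the closure of an open set \<open>U\<close> that are continuously differentiable in \<open>U\<close> and
  extend continuously, together with their gradient, to the closure.  No boundedness is required.
\<close>

definition C1_closure :: "'a::euclidean_space set \<Rightarrow> ('a \<Rightarrow> real) set" where
  "C1_closure U = {f. continuous_on (closure U) f \<and>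
     (\<exists>g. continuous_on (closure U) g \<and> (\<forall>x\<in>U. GDERIV f x :> g x))}"

text \<open>
  The completion of the \<open>C\<^sup>1\<close> functions of finite norm, realised as a space of functions: the
  measurable functions of finite norm form, modulo null sets, a Banach space for \<^const>\<open>S_norm\<close>
  (\<open>L\<^sup>p\<close> is complete, and the seminorm is lower semicontinuous under convergence almost everywhere
  by Fatou's lemma), so the completion is the closure of the \<open>C\<^sup>1\<close> functions in that space.
\<close>

definition S_space ::
    "real \<Rightarrow> real \<Rightarrow> real \<Rightarrow> 'a::euclidean_space set \<Rightarrow> ('a \<Rightarrow> real) set" where
  "S_space p \<delta> \<beta> U = {u. S_finite p \<delta> \<beta> U u \<and>
     (\<exists>\<phi>. (\<forall>n::nat. \<phi> n \<in> C1_closure U \<and> S_finite p \<delta> \<beta> U (\<phi> n)) \<and>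
          (\<lambda>n. S_norm p \<delta> \<beta> U (\<lambda>x. \<phi> n x - u x)) \<longlonglongrightarrow> 0)}"

definition T_semi_pow ::
    "real \<Rightarrow> real \<Rightarrow> real \<Rightarrow> 'a::euclidean_space set \<Rightarrow> ('a \<Rightarrow> real) \<Rightarrow> ennreal" where
  "T_semi_pow p \<delta> \<beta> V u =
     ennreal (\<delta> powr (\<beta> - 2)) *
     (\<integral>\<^sup>+x. (\<integral>\<^sup>+y. ennreal (\<bar>u y - u x\<bar> powr p /
          (max (norm (y - x)) \<delta> powr (real DIM('a) + p - 2) * min (norm (y - x)) \<delta> powr \<beta>))
        \<partial>lebesgue_on V) \<partial>lebesgue_on V)"

definition T_semi ::
    "real \<Rightarrow> real \<Rightarrow> real \<Rightarrow> 'a::euclidean_space set \<Rightarrow> ('a \<Rightarrow> real) \<Rightarrow> real" where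
  "T_semi p \<delta> \<beta> V u = enn2real (T_semi_pow p \<delta> \<beta> V u) powr (1 / p)"

definition T_norm ::
    "real \<Rightarrow> real \<Rightarrow> real \<Rightarrow> 'a::euclidean_space set \<Rightarrow> ('a \<Rightarrow> real) \<Rightarrow> real" where
  "T_norm p \<delta> \<beta> V u = (1 / \<delta> * Lp_norm p V u powr p + T_semi p \<delta> \<beta> V u powr p) powr (1 / p)"

definition T_space ::
    "real \<Rightarrow> real \<Rightarrow> real \<Rightarrow> 'a::euclidean_space set \<Rightarrow> ('a \<Rightarrow> real) set" where
  "T_space p \<delta> \<beta> V = {u. u \<in> borel_measurable (lebesgue_on V) \<and> Lp_pow p V u < \<infinity> \<and>
     T_semi_pow p \<delta> \<beta> V u < \<infinity>}"

text \<open>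
  The index type carries no order, so the normal coordinate is an arbitrary index \<open>k\<close> in the role
  of the first coordinate.
\<close>

definition strip :: "'n::finite \<Rightarrow> real \<Rightarrow> (real ^ 'n) set" where
  "strip k \<delta> = {x. - \<delta> < x $ k \<and> x $ k < 0}"

definition half_space :: "'n::finite \<Rightarrow> real \<Rightarrow> (real ^ 'n) set" where
  "half_space k \<delta> = {x. - \<delta> < x $ k}"

end

theory Submission
  imports Defs
begin

text \<open>
  The kernel factor \<open>r\<^sup>-\<^sup>\<beta>\<close> is at least \<open>\<delta>\<^sup>-\<^sup>\<beta>\<close> on its support, so the seminorm controls the energy
  \<open>E\<close> of the pairs at distance less than \<open>\<delta>\<close> without singular weight, and by scaling \<open>\<delta> = 1\<close>.

  For the \<open>L\<^sup>p\<close> bound, averaging gives one vector \<open>h\<close> with \<open>norm h < 1\<close> and \<open>h $ k > 1 / 2\<close> such that the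
  \<open>p\<close>-th power of the \<open>L\<^sup>p\<close> norm of \<open>u (x + h) - u x\<close> is at most a multiple of \<open>E\<close>.  The integral
  of \<open>\<bar>u\<bar>\<^sup>p\<close> over a slab of width \<open>h $ k\<close> is the difference of its integrals over a half-space and
  the translate of that half-space by \<open>h\<close>, which Hoelder's inequality bounds; two slabs cover the strip.

  For the seminorm bound, the pairs at distance less than \<open>\<delta>\<close> are controlled directly.  A pair
  \<open>x\<close>, \<open>y\<close> of the strip with \<open>8 * norm (y - x) < n\<close>, \<open>n = 2\<^sup>j\<close> of comparable size, is compared through
  points \<open>x + n h\<close> far inside the half-space, averaged over \<open>h\<close> in a ball.  This leaves the sum over
  \<open>j\<close> of \<open>2\<^bsup>j (1 - p)\<^esup>\<close> times the integral of \<open>\<bar>u (x + 2\<^sup>j h) - u x\<bar>\<^sup>p\<close>, which a dyadic Hardy inequality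
  along the sequence \<open>x, x + h, x + 2 h, \<dots>\<close> bounds by \<open>E\<close>.
\<close>


section \<open>Convexity of powers and a dyadic Hardy inequality\<close>

text \<open>Strictly positive points are covered by \<open>powr_convex\<close>; when one point is 0,
  the claim reduces to \<open>s powr p \<le> s\<close> for \<open>0 < s < 1\<close>.\<close>

lemma convex_on_powr_nonneg:
  fixes p :: real
  assumes "1 \<le> p"
  shows "convex_on {0..} (\<lambda>x. x powr p)"
proof (rule convex_onI)
  fix t x y :: real
  assume t: "0 < t" "t < 1" and xy: "x \<in> {0..}" "y \<in> {0..}"
  have zero: "(s * z) powr p \<le> s * z powr p" if "0 < s" "s < 1" "0 \<le> z" for s z :: real
  proof -
    have "s powr p \<le> s powr 1"
      using that assms by (intro powr_mono') auto
    then show ?thesis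
      using that by (auto simp: powr_mult intro: mult_right_mono)
  qed
  show "((1 - t) *\<^sub>R x + t *\<^sub>R y) powr p \<le> (1 - t) * x powr p + t * y powr p"
  proof (cases "x = 0 \<or> y = 0")
    case True
    then show ?thesis
      using zero[of t y] zero[of "1 - t" x] t xy by auto
  next
    case False
    then show ?thesis
      using convex_onD[OF powr_convex[OF assms], of t x y] t xy by auto
  qed
qed simp

text \<open>Convexity at the points \<open>a / t\<close> and \<open>b / (1 - t)\<close> with weights
  \<open>t\<close> and \<open>1 - t\<close>. Taking \<open>t\<close> above \<open>1 / 2\<close>
  lowers the coefficient of \<open>a powr p\<close>, which gives the contraction in
  \<open>dyadic_hardy\<close>.\<close>

lemma powr_add_le_weighted:
  fixes a b p t :: real
  assumes "1 \<le> p" "0 < t" "t < 1" "0 \<le> a" "0 \<le> b"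
  shows "(a + b) powr p \<le> t powr (1 - p) * a powr p + (1 - t) powr (1 - p) * b powr p"
proof -
  have scale: "s * (z / s) powr p = s powr (1 - p) * z powr p" if "0 < s" "0 \<le> z" for s z :: real
    using that by (simp add: powr_divide powr_diff)
  have "(a + b) powr p = ((1 - (1 - t)) *\<^sub>R (a / t) + (1 - t) *\<^sub>R (b / (1 - t))) powr p"
    using assms by simp
  also have "\<dots> \<le> (1 - (1 - t)) * (a / t) powr p + (1 - t) * (b / (1 - t)) powr p"
    by (rule convex_onD[OF convex_on_powr_nonneg[OF assms(1)]]) (use assms in auto)
  also have "\<dots> = t powr (1 - p) * a powr p + (1 - t) powr (1 - p) * b powr p"
    using scale[of t a] scale[of "1 - t" b] assms by simp
  finally show ?thesis .
qed

lemma powr_add_le: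
  fixes a b p :: real
  assumes "1 \<le> p" "0 \<le> a" "0 \<le> b"
  shows "(a + b) powr p \<le> 2 powr (p - 1) * (a powr p + b powr p)"
proof -
  have "(1 / 2 :: real) powr (1 - p) = 2 powr (p - 1)"
    by (simp add: powr_divide flip: powr_minus_divide)
  then show ?thesis
    using powr_add_le_weighted[of p "1 / 2" a b] assms by (simp add: distrib_left)
qed

text \<open>Jensen's inequality with equal weights \<open>1 / n\<close> at the points
  \<open>n * x i\<close>, where \<open>n\<close> is the number of terms.\<close>

lemma sum_powr_le:
  fixes x :: "'i \<Rightarrow> real"
  assumes "1 \<le> p" "finite I" "\<And>i. i \<in> I \<Longrightarrow> 0 \<le> x i"
  shows "(\<Sum>i\<in>I. x i) powr p \<le> real (card I) powr (p - 1) * (\<Sum>i\<in>I. x i powr p)"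
proof (cases "I = {}")
  case False
  define n where "n = real (card I)"
  have n: "0 < n"
    using False assms(2) by (simp add: n_def card_gt_0_iff)
  have "(\<Sum>i\<in>I. (1 / n) *\<^sub>R (n * x i)) powr p \<le> (\<Sum>i\<in>I. (1 / n) * (n * x i) powr p)"
    using False assms n
    by (intro convex_on_sum[where C = "{0..}" and f = "\<lambda>x. x powr p"] convex_on_powr_nonneg)
      (auto simp: n_def)
  also have "\<dots> = (\<Sum>i\<in>I. n powr (p - 1) * x i powr p)"
    using n assms(3) by (intro sum.cong) (auto simp: powr_mult powr_diff)
  finally show ?thesis
    using n by (simp add: sum_distrib_left n_def)
qed simp

text \<open>Mean value theorem: the power \<open>p - 1\<close> of the intermediate point is at most
  that of the larger argument, and the sum of both powers keeps the bound symmetric.\<close>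

lemma abs_powr_diff_le:
  fixes a b p :: real
  assumes "1 \<le> p" "0 \<le> a" "0 \<le> b"
  shows "\<bar>a powr p - b powr p\<bar> \<le> p * \<bar>a - b\<bar> * (a powr (p - 1) + b powr (p - 1))"
proof -
  have le: "\<bar>a powr p - b powr p\<bar> \<le> p * \<bar>a - b\<bar> * (a powr (p - 1) + b powr (p - 1))"
    if ab: "0 \<le> b" "b < a" for a b :: real
  proof -
    have "continuous_on {b..a} (\<lambda>x. x powr p)"
      using assms(1) ab by (intro continuous_on_powr' continuous_intros) auto
    moreover have deriv: "((\<lambda>x. x powr p) has_real_derivative p * x powr (p - 1)) (at x)" if "b < x" for x
      using that ab by (auto intro!: derivative_eq_intros simp: powr_diff field_simps)
    ultimately obtain z l where zl: "b < z" "z < a"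
        "((\<lambda>x. x powr p) has_real_derivative l) (at z)" "a powr p - b powr p = (a - b) * l"
      using MVT[of b a "\<lambda>x. x powr p"] ab by (metis real_differentiable_def)
    moreover have "l = p * z powr (p - 1)"
      using deriv zl DERIV_unique by blast
    ultimately have z: "b < z" "z < a" "a powr p - b powr p = (a - b) * (p * z powr (p - 1))"
      by auto
    have "z powr (p - 1) \<le> a powr (p - 1) + b powr (p - 1)"
      using z ab assms(1) by (intro add_increasing2 powr_mono2) auto
    then have "(a - b) * (p * z powr (p - 1)) \<le> (a - b) * (p * (a powr (p - 1) + b powr (p - 1)))"
      using ab assms(1) by (intro mult_left_mono) auto
    moreover have "b powr p \<le> a powr p"
      using ab assms(1) by (intro powr_mono2) auto
    ultimately show ?thesis
      using z ab by (simp add: mult_ac)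
  qed
  show ?thesis
    using le[of a b] le[of b a] assms by (cases a b rule: linorder_cases) (auto simp: abs_minus_commute add.commute)
qed

text \<open>The difference telescopes over \<open>2 ^ j\<close> increments, so
  \<open>sum_powr_le\<close> costs the factor \<open>(2 ^ j) powr (p - 1)\<close>.\<close>

lemma dyadic_block:
  fixes s :: "nat \<Rightarrow> real"
  assumes "1 \<le> p"
  shows "\<bar>s (2 ^ Suc j) - s (2 ^ j)\<bar> powr p
    \<le> 2 powr (real j * (p - 1)) * (\<Sum>k\<in>{2^j..<2^Suc j}. \<bar>s (Suc k) - s k\<bar> powr p)"
proof -
  have "s (2 ^ Suc j) - s (2 ^ j) = (\<Sum>k\<in>{2^j..<2^Suc j}. s (Suc k) - s k)"
    by (subst sum_Suc_diff') auto
  then have "\<bar>s (2 ^ Suc j) - s (2 ^ j)\<bar> powr p \<le> (\<Sum>k\<in>{2^j..<2^Suc j}. \<bar>s (Suc k) - s k\<bar>) powr p"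
    using assms by (intro powr_mono2) (auto simp only: sum_abs abs_ge_zero)
  also have "\<dots> \<le> real (card {2^j..<2^Suc j::nat}) powr (p - 1) * (\<Sum>k\<in>{2^j..<2^Suc j}. \<bar>s (Suc k) - s k\<bar> powr p)"
    using assms by (intro sum_powr_le) auto
  also have "real (card {2^j..<2^Suc j::nat}) = 2 powr real j"
    by (simp add: powr_realpow)
  finally show ?thesis
    by (simp add: powr_powr)
qed

text \<open>This is \<open>(1 + M) / (1 - q)\<close> for the recursion
  \<open>S (Suc j) \<le> q * S j + M * e j\<close> in the proof of \<open>dyadic_hardy\<close>;
  there \<open>q = 2 powr ((1 - p) / 2)\<close> is below 1 because \<open>1 < p\<close>.\<close>

definition hardy_const :: "real \<Rightarrow> real" where
  "hardy_const p = (1 + (1 - 2 powr (- 1 / 2)) powr (1 - p)) / (1 - 2 powr ((1 - p) / 2))"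

lemma hardy_const_pos: "1 < p \<Longrightarrow> 0 < hardy_const p"
  unfolding hardy_const_def by (intro divide_pos_pos add_pos_nonneg) (auto simp: powr_less_one)

text \<open>The weighted terms obey a recursion with ratio below 1, so their sum is controlled by
  the increments that drive it, uniformly in \<open>N\<close>.\<close>

lemma dyadic_hardy:
  fixes s :: "nat \<Rightarrow> real"
  assumes p: "1 < p"
  shows "(\<Sum>j\<le>N. 2 powr (real j * (1 - p)) * \<bar>s (2 ^ j) - s 0\<bar> powr p)
    \<le> hardy_const p * (\<Sum>k<2^N. \<bar>s (Suc k) - s k\<bar> powr p)"
proof -
  define q where "q = (2::real) powr ((1 - p) / 2)"
  define M where "M = (1 - (2::real) powr (- 1 / 2)) powr (1 - p)"
  define S where "S j = 2 powr (real j * (1 - p)) * \<bar>s (2 ^ j) - s 0\<bar> powr p" for j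
  define e where "e j = (\<Sum>k\<in>{2^j..<2^Suc j}. \<bar>s (Suc k) - s k\<bar> powr p)" for j
  define E where "E j = (\<Sum>k<2^j. \<bar>s (Suc k) - s k\<bar> powr p)" for j
  have q: "0 < q" "q < 1"
    using p by (auto simp: q_def powr_less_one)
  have M: "0 \<le> M"
    by (simp add: M_def)
  have C: "hardy_const p = (1 + M) / (1 - q)"
    by (simp add: hardy_const_def q_def M_def)
  have e0: "0 \<le> e j" for j
    by (auto simp: e_def intro: sum_nonneg)
  have E_Suc: "E (Suc j) = E j + e j" for j
    unfolding E_def e_def lessThan_atLeast0 by (subst sum.atLeastLessThan_concat) auto
  have S0: "0 \<le> S j" for j
    by (simp add: S_def)
  have step: "S (Suc j) \<le> q * S j + M * e j" for j
  proof -
    \<comment> \<open>Passing from \<open>j\<close> to \<open>Suc j\<close> multiplies the weight by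
      \<open>2 powr (1 - p)\<close>. The value \<open>1 / 2\<close> would cancel this gain
      completely; \<open>2 powr (- 1 / 2)\<close> uses up half of the exponent and leaves
      \<open>q < 1\<close>.\<close>
    let ?t = "2 powr (- 1 / 2) :: real"
    let ?w = "2 powr (real (Suc j) * (1 - p)) :: real"
    have t: "0 < ?t" "?t < 1"
      by (auto simp: powr_less_one)
    have "\<bar>s (2 ^ Suc j) - s 0\<bar> powr p \<le> (\<bar>s (2 ^ j) - s 0\<bar> + \<bar>s (2 ^ Suc j) - s (2 ^ j)\<bar>) powr p"
      using p by (intro powr_mono2) auto
    also have "\<dots> \<le> ?t powr (1 - p) * \<bar>s (2 ^ j) - s 0\<bar> powr p + M * \<bar>s (2 ^ Suc j) - s (2 ^ j)\<bar> powr p"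
      unfolding M_def using p t by (intro powr_add_le_weighted) auto
    also have "\<dots> \<le> ?t powr (1 - p) * \<bar>s (2 ^ j) - s 0\<bar> powr p + M * (2 powr (real j * (p - 1)) * e j)"
      unfolding e_def using p M by (intro add_left_mono mult_left_mono dyadic_block) auto
    finally have "S (Suc j) \<le> ?w * (?t powr (1 - p) * \<bar>s (2 ^ j) - s 0\<bar> powr p + M * (2 powr (real j * (p - 1)) * e j))"
      unfolding S_def by (intro mult_left_mono) auto
    also have "\<dots> = (?w * ?t powr (1 - p)) * \<bar>s (2 ^ j) - s 0\<bar> powr p + M * (?w * 2 powr (real j * (p - 1))) * e j"
      by (simp add: algebra_simps)
    also have "?w * ?t powr (1 - p) = q * 2 powr (real j * (1 - p))"
      by (simp add: q_def powr_powr field_simps flip: powr_add)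
    also have "?w * 2 powr (real j * (p - 1)) = 2 powr (1 - p)"
      by (simp add: algebra_simps flip: powr_add)
    also have "q * 2 powr (real j * (1 - p)) * \<bar>s (2 ^ j) - s 0\<bar> powr p = q * S j"
      by (simp add: S_def)
    also have "M * 2 powr (1 - p) * e j \<le> M * 1 * e j"
      using p M e0 by (intro mult_right_mono mult_left_mono) (auto intro: less_imp_le[OF powr_less_one])
    finally show ?thesis
      by simp
  qed
  \<comment> \<open>The extra term pays for the \<open>q * S N\<close> of the next step of the
    recursion, because \<open>1 + q / (1 - q) = 1 / (1 - q)\<close>. For \<open>N = 0\<close> both
    \<open>S 0\<close> and \<open>E 0\<close> are the single power
    \<open>\<bar>s 1 - s 0\<bar> powr p\<close>.\<close>
  have "(\<Sum>j\<le>N. S j) + q / (1 - q) * S N \<le> hardy_const p * E N"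
  proof (induction N)
    case 0
    have "S 0 + q / (1 - q) * S 0 = 1 / (1 - q) * S 0"
      using q by (simp add: field_simps)
    also have "\<dots> \<le> (1 + M) / (1 - q) * S 0"
      using q M S0 by (intro mult_right_mono divide_right_mono) auto
    finally show ?case
      by (simp add: C E_def S_def lessThan_Suc)
  next
    case (Suc N)
    have "(\<Sum>j\<le>Suc N. S j) + q / (1 - q) * S (Suc N) = (\<Sum>j\<le>N. S j) + 1 / (1 - q) * S (Suc N)"
      using q by (simp add: field_simps)
    also have "\<dots> \<le> (\<Sum>j\<le>N. S j) + 1 / (1 - q) * (q * S N + M * e N)"
      using q step by (intro add_left_mono mult_left_mono) auto
    also have "\<dots> = ((\<Sum>j\<le>N. S j) + q / (1 - q) * S N) + M / (1 - q) * e N"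
      by (simp add: algebra_simps add_divide_distrib)
    also have "\<dots> \<le> hardy_const p * E N + (1 + M) / (1 - q) * e N"
      using Suc q e0 by (intro add_mono mult_right_mono divide_right_mono) auto
    finally show ?case
      by (simp add: C E_Suc distrib_left)
  qed
  moreover have "0 \<le> q / (1 - q) * S N"
    using q S0 by simp
  ultimately show ?thesis
    by (simp add: S_def E_def)
qed

section \<open>Integration over Euclidean space\<close>

text \<open>Young's inequality after dividing \<open>f\<close> and \<open>g\<close> by their norms
  \<open>a\<close> and \<open>b\<close>. If one norm is 0, the product vanishes almost
  everywhere.\<close>

lemma nn_integral_Holder:
  fixes f g :: "'a \<Rightarrow> real"
  assumes [measurable]: "f \<in> borel_measurable M" "g \<in> borel_measurable M"
    and nonneg: "\<And>x. 0 \<le> f x" "\<And>x. 0 \<le> g x"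
    and pq: "1 < p" "1 < q" "1 / p + 1 / q = 1"
    and X: "0 \<le> X" "(\<integral>\<^sup>+x. ennreal (f x powr p) \<partial>M) = ennreal X"
    and Y: "0 \<le> Y" "(\<integral>\<^sup>+x. ennreal (g x powr q) \<partial>M) = ennreal Y"
  shows "(\<integral>\<^sup>+x. ennreal (f x * g x) \<partial>M) \<le> ennreal (X powr (1 / p) * Y powr (1 / q))"
proof (cases "X = 0 \<or> Y = 0")
  case True
  then have "(AE x in M. ennreal (f x powr p) = 0) \<or> (AE x in M. ennreal (g x powr q) = 0)"
    using X(2) Y(2) by (subst (1 2) nn_integral_0_iff_AE[symmetric]) auto
  then have "AE x in M. ennreal (f x * g x) = 0"
    by (auto elim: eventually_mono)
  then have "(\<integral>\<^sup>+x. ennreal (f x * g x) \<partial>M) = 0"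
    by (subst nn_integral_0_iff_AE) auto
  then show ?thesis
    by simp
next
  case False
  define a b where "a = X powr (1 / p)" and "b = Y powr (1 / q)"
  have ab: "0 < a" "0 < b" "a powr p = X" "b powr q = Y"
    using False X(1) Y(1) pq by (auto simp: a_def b_def powr_powr)
  have "f x * g x \<le> a * b / (p * X) * f x powr p + a * b / (q * Y) * g x powr q" for x
  proof -
    have "f x * g x = a * b * ((f x / a) * (g x / b))"
      using ab by simp
    also have "\<dots> \<le> a * b * ((f x / a) powr p / p + (g x / b) powr q / q)"
      using ab nonneg pq by (intro mult_left_mono Youngs_inequality) auto
    also have "\<dots> = a * b / (p * X) * f x powr p + a * b / (q * Y) * g x powr q"
      using ab nonneg[of x] by (simp add: powr_divide distrib_left mult_ac)
    finally show ?thesis .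
  qed
  then have "(\<integral>\<^sup>+x. ennreal (f x * g x) \<partial>M)
      \<le> (\<integral>\<^sup>+x. ennreal (a * b / (p * X)) * ennreal (f x powr p)
           + ennreal (a * b / (q * Y)) * ennreal (g x powr q) \<partial>M)"
    using ab X(1) Y(1) pq by (intro nn_integral_mono) (auto simp flip: ennreal_mult' ennreal_plus)
  also have "\<dots> = ennreal (a * b / (p * X)) * ennreal X + ennreal (a * b / (q * Y)) * ennreal Y"
    by (subst nn_integral_add) (auto simp: nn_integral_cmult X Y)
  also have "\<dots> = ennreal (a * b / p + a * b / q)"
    using ab X(1) Y(1) pq False by (simp flip: ennreal_mult' ennreal_plus)
  also have "a * b / p + a * b / q = a * b"
    using pq(3) by (metis distrib_left mult.right_neutral times_divide_eq_right)
  finally show ?thesis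
    by (simp add: a_def b_def)
qed

section \<open>Translations, dilations and Borel representatives\<close>

lemma nn_integral_lborel_translate_left:
  fixes f :: "'a::euclidean_space \<Rightarrow> ennreal"
  assumes [measurable]: "f \<in> borel_measurable borel"
  shows "(\<integral>\<^sup>+x. f (c + x) \<partial>lborel) = (\<integral>\<^sup>+x. f x \<partial>lborel)"
proof -
  have "(\<integral>\<^sup>+x. f x \<partial>lborel) = (\<integral>\<^sup>+x. f x \<partial>distr lborel borel ((+) c))"
    by (simp add: lborel_distr_plus)
  also have "\<dots> = (\<integral>\<^sup>+x. f (c + x) \<partial>lborel)"
    by (subst nn_integral_distr) auto
  finally show ?thesis ..
qed

lemma nn_integral_lborel_translate:
  fixes f :: "'a::euclidean_space \<Rightarrow> ennreal"
  assumes "f \<in> borel_measurable borel"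
  shows "(\<integral>\<^sup>+x. f (x + c) \<partial>lborel) = (\<integral>\<^sup>+x. f x \<partial>lborel)"
  using nn_integral_lborel_translate_left[OF assms, of c] by (simp add: add.commute)

lemma nn_integral_lborel_scaleR:
  fixes f :: "'a::euclidean_space \<Rightarrow> ennreal"
  assumes [measurable]: "f \<in> borel_measurable borel" and "0 < c"
  shows "(\<integral>\<^sup>+x. f x \<partial>lborel) = ennreal (c ^ DIM('a)) * (\<integral>\<^sup>+x. f (c *\<^sub>R x) \<partial>lborel)"
proof -
  have "(\<integral>\<^sup>+x. f x \<partial>lborel) = (\<integral>\<^sup>+x. f x \<partial>density (distr lborel borel (\<lambda>x. 0 + c *\<^sub>R x)) (\<lambda>_. \<bar>c\<bar>^DIM('a)))"
    using lborel_affine[of c "0::'a"] assms(2) by simp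
  also have "\<dots> = ennreal (c ^ DIM('a)) * (\<integral>\<^sup>+x. f (c *\<^sub>R x) \<partial>lborel)"
    using assms(2) by (simp add: nn_integral_density nn_integral_distr nn_integral_cmult)
  finally show ?thesis .
qed

text \<open>Extending \<open>u\<close> by 0 outside \<open>U\<close> gives a function measurable for
  the completed measure, which agrees almost everywhere with a Borel function. Borel measurability
  is what later justifies changes of variables and exchanges of integrals.\<close>

lemma lborel_borel_representative:
  fixes u :: "'a::euclidean_space \<Rightarrow> real"
  assumes U: "U \<in> sets borel" and u: "u \<in> borel_measurable (lebesgue_on U)"
  obtains v where "v \<in> borel_measurable borel" "AE x in lborel. x \<in> U \<longrightarrow> u x = v x"
proof -
  have "(\<lambda>x. if x \<in> U then u x else 0) \<in> borel_measurable lebesgue"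
    using u U by (subst (asm) measurable_restrict_space_iff[where c = 0]) (auto simp: if_distrib)
  then obtain v where v: "v \<in> borel_measurable lborel"
      "AE x in lborel. (if x \<in> U then u x else 0) = v x"
    using completion_ex_borel_measurable_real by blast
  show thesis
  proof (rule that[of v])
    show "AE x in lborel. x \<in> U \<longrightarrow> u x = v x"
      using v(2) by eventually_elim auto
  qed (use v(1) in simp)
qed

lemma nn_integral_lebesgue_on:
  fixes f :: "'a::euclidean_space \<Rightarrow> ennreal"
  assumes "U \<in> sets borel"
  shows "(\<integral>\<^sup>+x. f x \<partial>lebesgue_on U) = (\<integral>\<^sup>+x\<in>U. f x \<partial>lborel)"
  using assms by (simp add: nn_integral_restrict_space nn_integral_completion)

text \<open>If \<open>f\<close> exceeded the bound everywhere on \<open>H\<close>, its integral over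
  \<open>H\<close> would be at least \<open>2 * c\<close>. This leads from an average over
  translations to a single translation.\<close>

lemma exists_le_average:
  fixes f :: "'a \<Rightarrow> ennreal"
  assumes [measurable]: "f \<in> borel_measurable M" "H \<in> sets M"
    and H: "emeasure M H = ennreal m" "0 < m"
    and c: "0 \<le> c" "(\<integral>\<^sup>+x\<in>H. f x \<partial>M) \<le> ennreal c"
  shows "\<exists>x\<in>H. f x \<le> ennreal (2 * c / m)"
proof (rule ccontr)
  assume "\<not> ?thesis"
  then have less: "ennreal (2 * c / m) < f x" if "x \<in> H" for x
    using that by (auto simp: not_le)
  have "ennreal (2 * c / m) * emeasure M H = (\<integral>\<^sup>+x. ennreal (2 * c / m) * indicator H x \<partial>M)"
    by (subst nn_integral_cmult_indicator) auto
  also have "\<dots> \<le> (\<integral>\<^sup>+x\<in>H. f x \<partial>M)"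
    by (intro nn_integral_mono) (auto simp: indicator_def less less_imp_le)
  finally have "ennreal (2 * c) \<le> ennreal c"
    using H c order_trans by (fastforce simp flip: ennreal_mult')
  \<comment> \<open>Only \<open>c = 0\<close> survives; then \<open>f\<close> vanishes almost
    everywhere on \<open>H\<close> although it is strictly positive there, so \<open>H\<close> would
    be a null set.\<close>
  then have "c = 0"
    using c(1) by simp
  then have "(\<integral>\<^sup>+x\<in>H. f x \<partial>M) = 0"
    using c(2) by simp
  then have "AE x in M. f x * indicator H x = 0"
    by (subst (asm) nn_integral_0_iff_AE) auto
  then have "AE x in M. x \<notin> H"
  proof eventually_elim
    case (elim x)
    then show ?case
      using less[of x] by (cases "x \<in> H") auto
  qed
  then have "emeasure M H = 0"
    by (auto simp flip: AE_iff_null_sets)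
  then show False
    using H by simp
qed

section \<open>The strip norm through a single translation\<close>

definition shift_energy :: "real \<Rightarrow> 'a::euclidean_space set \<Rightarrow> ('a \<Rightarrow> real) \<Rightarrow> 'a \<Rightarrow> ennreal" where
  "shift_energy p U u h = (\<integral>\<^sup>+x\<in>U. ennreal (\<bar>u (x + h) - u x\<bar> powr p) \<partial>lborel)"

definition near_energy :: "real \<Rightarrow> real \<Rightarrow> 'a::euclidean_space set \<Rightarrow> ('a \<Rightarrow> real) \<Rightarrow> ennreal" where
  "near_energy p \<delta> U u = (\<integral>\<^sup>+x\<in>U. (\<integral>\<^sup>+y\<in>U.
     (if norm (y - x) < \<delta> then ennreal (\<bar>u y - u x\<bar> powr p) else 0) \<partial>lborel) \<partial>lborel)"

text \<open>Centre and radius are chosen so that every \<open>h\<close> in the ball has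
  \<open>norm h < 1\<close>, which keeps \<open>x\<close> and \<open>x + h\<close> a near pair, and
  \<open>h $ k > 1 / 2\<close>, so that two steps cross the strip of width 1.\<close>

definition step_ball :: "'n::finite \<Rightarrow> (real ^ 'n) set" where
  "step_ball k = ball ((3 / 4) *\<^sub>R axis k 1) (1 / 4)"

lemma step_ballD:
  fixes k :: "'n::finite"
  assumes "h \<in> step_ball k"
  shows "1 / 2 < h $ k" "norm h < 1"
proof -
  let ?c = "(3 / 4) *\<^sub>R axis k 1 :: real ^ 'n"
  have d: "norm (h - ?c) < 1 / 4"
    using assms by (simp add: step_ball_def dist_norm norm_minus_commute)
  have "\<bar>(h - ?c) $ k\<bar> < 1 / 4"
    using component_le_norm_cart[of "h - ?c" k] d by linarith
  then have "\<bar>h $ k - 3 / 4\<bar> < 1 / 4"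
    by (simp add: axis_def)
  then show "1 / 2 < h $ k"
    by linarith
  have "norm h \<le> norm (h - ?c) + norm ?c"
    using norm_triangle_ineq[of "h - ?c" ?c] by simp
  then show "norm h < 1"
    using d by (simp add: norm_axis_1)
qed

lemma sets_half_space [measurable]: "half_space k \<delta> \<in> sets borel"
  and sets_strip [measurable]: "strip k \<delta> \<in> sets borel"
  and sets_step_ball [measurable]: "step_ball k \<in> sets borel"
  unfolding half_space_def strip_def step_ball_def by measurable

lemma shift_energy_measurable [measurable]:
  fixes u :: "'a::euclidean_space \<Rightarrow> real"
  assumes [measurable]: "u \<in> borel_measurable borel" "U \<in> sets borel"
  shows "shift_energy p U u \<in> borel_measurable borel"
  unfolding shift_energy_def by measurable

text \<open>Substituting \<open>y = x + h\<close> turns the left side into part of the near energy: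
  \<open>norm h < 1\<close> keeps the pair close, and \<open>h $ k > 0\<close> keeps
  \<open>x + h\<close> in the half-space.\<close>

lemma nn_integral_shift_energy_le:
  fixes u :: "real ^ 'n \<Rightarrow> real"
  assumes [measurable]: "u \<in> borel_measurable borel"
  shows "(\<integral>\<^sup>+h\<in>step_ball k. shift_energy p (half_space k 1) u h \<partial>lborel) \<le> near_energy p 1 (half_space k 1) u"
proof -
  let ?A = "half_space k 1"
  let ?g = "\<lambda>x h. ennreal (\<bar>u (x + h) - u x\<bar> powr p)"
  have "(\<integral>\<^sup>+h\<in>step_ball k. shift_energy p ?A u h \<partial>lborel)
      = (\<integral>\<^sup>+h. (\<integral>\<^sup>+x. ?g x h * indicator ?A x * indicator (step_ball k) h \<partial>lborel) \<partial>lborel)"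
    unfolding shift_energy_def by (subst nn_integral_multc) auto
  also have "\<dots> = (\<integral>\<^sup>+x. (\<integral>\<^sup>+h. ?g x h * indicator ?A x * indicator (step_ball k) h \<partial>lborel) \<partial>lborel)"
    by (rule lborel_pair.Fubini') measurable
  also have "\<dots> \<le> (\<integral>\<^sup>+x. (\<integral>\<^sup>+h. (if norm h < 1 then ?g x h else 0) * indicator ?A (x + h) * indicator ?A x \<partial>lborel) \<partial>lborel)"
    by (intro nn_integral_mono)
      (auto simp: indicator_def half_space_def dest: step_ballD split: if_splits)
  also have "\<dots> = (\<integral>\<^sup>+x. (\<integral>\<^sup>+y. (if norm (y - x) < 1 then ennreal (\<bar>u y - u x\<bar> powr p) else 0)
      * indicator ?A y * indicator ?A x \<partial>lborel) \<partial>lborel)"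
  proof (rule nn_integral_cong)
    fix x :: "real ^ 'n"
    show "(\<integral>\<^sup>+h. (if norm h < 1 then ?g x h else 0) * indicator ?A (x + h) * indicator ?A x \<partial>lborel)
      = (\<integral>\<^sup>+y. (if norm (y - x) < 1 then ennreal (\<bar>u y - u x\<bar> powr p) else 0) * indicator ?A y * indicator ?A x \<partial>lborel)"
      using nn_integral_lborel_translate_left[where c = x and f = "\<lambda>y. (if norm (y - x) < 1
        then ennreal (\<bar>u y - u x\<bar> powr p) else 0) * indicator ?A y * indicator ?A x"]
      by simp
  qed
  also have "\<dots> = near_energy p 1 ?A u"
    unfolding near_energy_def by (subst nn_integral_multc) auto
  finally show ?thesis .
qed

text \<open>The slab is \<open>?P\<close> minus its translate \<open>?Q\<close> by \<open>h\<close>.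
  Bounding \<open>w x\<close> by \<open>w (x + h) + \<bar>w (x + h) - w x\<bar>\<close> on
  \<open>?P\<close> produces the integral over \<open>?Q\<close> again, and \<open>fin\<close>
  allows cancelling it.\<close>

lemma slab_integral_le:
  fixes w :: "real ^ 'n \<Rightarrow> real"
  assumes [measurable]: "w \<in> borel_measurable borel" and nonneg: "\<And>x. 0 \<le> w x"
    and h: "0 < h $ k" and fin: "(\<integral>\<^sup>+x\<in>{x. b + h $ k < x $ k}. ennreal (w x) \<partial>lborel) < \<infinity>"
  shows "(\<integral>\<^sup>+x\<in>{x. b < x $ k \<and> x $ k \<le> b + h $ k}. ennreal (w x) \<partial>lborel)
    \<le> (\<integral>\<^sup>+x\<in>{x. b < x $ k}. ennreal \<bar>w (x + h) - w x\<bar> \<partial>lborel)"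
proof -
  let ?P = "{x. b < x $ k} :: (real ^ 'n) set" and ?Q = "{x. b + h $ k < x $ k} :: (real ^ 'n) set"
  let ?S = "{x. b < x $ k \<and> x $ k \<le> b + h $ k} :: (real ^ 'n) set"
  have "(\<integral>\<^sup>+x\<in>?Q. ennreal (w x) \<partial>lborel) + (\<integral>\<^sup>+x\<in>?S. ennreal (w x) \<partial>lborel) = (\<integral>\<^sup>+x\<in>?P. ennreal (w x) \<partial>lborel)"
    by (subst nn_integral_add[symmetric]) (use h in \<open>auto intro!: nn_integral_cong simp: indicator_def\<close>)
  also have "\<dots> \<le> (\<integral>\<^sup>+x. ennreal (w (x + h)) * indicator ?Q (x + h) + ennreal \<bar>w (x + h) - w x\<bar> * indicator ?P x \<partial>lborel)"
    using nonneg by (intro nn_integral_mono) (auto simp: indicator_def simp flip: ennreal_plus)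
  also have "\<dots> = (\<integral>\<^sup>+x. ennreal (w (x + h)) * indicator ?Q (x + h) \<partial>lborel)
      + (\<integral>\<^sup>+x\<in>?P. ennreal \<bar>w (x + h) - w x\<bar> \<partial>lborel)"
    by (rule nn_integral_add) auto
  also have "(\<integral>\<^sup>+x. ennreal (w (x + h)) * indicator ?Q (x + h) \<partial>lborel) = (\<integral>\<^sup>+x\<in>?Q. ennreal (w x) \<partial>lborel)"
    by (subst nn_integral_lborel_translate[where f = "\<lambda>x. ennreal (w x) * indicator ?Q x"]) auto
  finally show ?thesis
    using fin by (auto simp: ennreal_add_left_cancel_le)
qed

text \<open>The slabs of width \<open>h $ k > 1 / 2\<close> that begin at \<open>- 1\<close> and at
  \<open>- 1 + h $ k\<close> cover the strip; each contributes one copy of the integral on the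
  right.\<close>

lemma strip_integral_le:
  fixes w :: "real ^ 'n \<Rightarrow> real"
  assumes [measurable]: "w \<in> borel_measurable borel" and nonneg: "\<And>x. 0 \<le> w x"
    and h: "1 / 2 < h $ k" and fin: "(\<integral>\<^sup>+x\<in>half_space k 1. ennreal (w x) \<partial>lborel) < \<infinity>"
  shows "(\<integral>\<^sup>+x\<in>strip k 1. ennreal (w x) \<partial>lborel)
    \<le> 2 * (\<integral>\<^sup>+x\<in>half_space k 1. ennreal \<bar>w (x + h) - w x\<bar> \<partial>lborel)"
proof -
  let ?S = "\<lambda>b. {x. b < x $ k \<and> x $ k \<le> b + h $ k} :: (real ^ 'n) set"
  let ?P = "\<lambda>b. {x. b < x $ k} :: (real ^ 'n) set"
  have slab: "(\<integral>\<^sup>+x\<in>?S b. ennreal (w x) \<partial>lborel) \<le> (\<integral>\<^sup>+x\<in>half_space k 1. ennreal \<bar>w (x + h) - w x\<bar> \<partial>lborel)"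
    if "- 1 \<le> b" for b
  proof -
    have "(\<integral>\<^sup>+x\<in>?P (b + h $ k). ennreal (w x) \<partial>lborel) \<le> (\<integral>\<^sup>+x\<in>half_space k 1. ennreal (w x) \<partial>lborel)"
      using that h by (intro nn_set_integral_set_mono) (auto simp: half_space_def)
    then have "(\<integral>\<^sup>+x\<in>?S b. ennreal (w x) \<partial>lborel) \<le> (\<integral>\<^sup>+x\<in>?P b. ennreal \<bar>w (x + h) - w x\<bar> \<partial>lborel)"
      using h fin nonneg by (intro slab_integral_le) auto
    also have "\<dots> \<le> (\<integral>\<^sup>+x\<in>half_space k 1. ennreal \<bar>w (x + h) - w x\<bar> \<partial>lborel)"
      using that by (intro nn_set_integral_set_mono) (auto simp: half_space_def)
    finally show ?thesis .
  qed
  have "(\<integral>\<^sup>+x\<in>strip k 1. ennreal (w x) \<partial>lborel)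
      \<le> (\<integral>\<^sup>+x. ennreal (w x) * indicator (?S (- 1)) x + ennreal (w x) * indicator (?S (- 1 + h $ k)) x \<partial>lborel)"
    using h by (intro nn_integral_mono) (auto simp: indicator_def strip_def)
  also have "\<dots> = (\<integral>\<^sup>+x\<in>?S (- 1). ennreal (w x) \<partial>lborel) + (\<integral>\<^sup>+x\<in>?S (- 1 + h $ k). ennreal (w x) \<partial>lborel)"
    by (rule nn_integral_add) auto
  also have "\<dots> \<le> 2 * (\<integral>\<^sup>+x\<in>half_space k 1. ennreal \<bar>w (x + h) - w x\<bar> \<partial>lborel)"
    unfolding mult_2 using h by (intro add_mono slab) auto
  finally show ?thesis .
qed

text \<open>\<open>nn_integral_Holder\<close> with conjugate exponent \<open>p / (p - 1)\<close>.
  The hypotheses ask for upper bounds only, since no more is known of the translated function and of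
  the shift energy.\<close>

lemma nn_integral_Holder_powr:
  fixes f g :: "'a \<Rightarrow> real"
  assumes [measurable]: "f \<in> borel_measurable M" "g \<in> borel_measurable M"
    and p: "1 < p" and X: "0 \<le> X" "(\<integral>\<^sup>+x. ennreal (\<bar>f x\<bar> powr p) \<partial>M) \<le> ennreal X"
    and Y: "0 \<le> Y" "(\<integral>\<^sup>+x. ennreal (\<bar>g x\<bar> powr p) \<partial>M) \<le> ennreal Y"
  shows "(\<integral>\<^sup>+x. ennreal (\<bar>f x\<bar> * \<bar>g x\<bar> powr (p - 1)) \<partial>M) \<le> ennreal (X powr (1 / p) * Y powr ((p - 1) / p))"
proof -
  define X' where "X' = enn2real (\<integral>\<^sup>+x. ennreal (\<bar>f x\<bar> powr p) \<partial>M)"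
  define Y' where "Y' = enn2real (\<integral>\<^sup>+x. ennreal (\<bar>g x\<bar> powr p) \<partial>M)"
  have X': "(\<integral>\<^sup>+x. ennreal (\<bar>f x\<bar> powr p) \<partial>M) = ennreal X'" "0 \<le> X'" "X' \<le> X"
    unfolding X'_def using X le_less_trans[OF X(2) ennreal_less_top] by (auto simp: enn2real_leI)
  have Y': "(\<integral>\<^sup>+x. ennreal (\<bar>g x\<bar> powr p) \<partial>M) = ennreal Y'" "0 \<le> Y'" "Y' \<le> Y"
    unfolding Y'_def using Y le_less_trans[OF Y(2) ennreal_less_top] by (auto simp: enn2real_leI)
  have "(\<bar>g x\<bar> powr (p - 1)) powr (p / (p - 1)) = \<bar>g x\<bar> powr p" for x
    using p by (simp add: powr_powr)
  then have "(\<integral>\<^sup>+x. ennreal (\<bar>f x\<bar> * \<bar>g x\<bar> powr (p - 1)) \<partial>M)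
      \<le> ennreal (X' powr (1 / p) * Y' powr (1 / (p / (p - 1))))"
    using p X' Y' by (intro nn_integral_Holder) (auto simp: field_simps)
  also have "\<dots> \<le> ennreal (X powr (1 / p) * Y powr ((p - 1) / p))"
    using p X' Y' by (intro ennreal_leI mult_mono) (auto intro: powr_mono2)
  finally show ?thesis .
qed

text \<open>\<open>abs_powr_diff_le\<close> gives one product with
  \<open>\<bar>u (x + h)\<bar> powr (p - 1)\<close> and one with
  \<open>\<bar>u x\<bar> powr (p - 1)\<close>; Hoelder's inequality bounds both by the same
  quantity, whence \<open>2 * p\<close>.\<close>

lemma shifted_powr_diff_integral_le:
  fixes u :: "real ^ 'n \<Rightarrow> real"
  assumes [measurable]: "u \<in> borel_measurable borel" and p: "1 < p" and h: "0 \<le> h $ k"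
    and N: "0 \<le> N" "(\<integral>\<^sup>+x\<in>half_space k 1. ennreal (\<bar>u x\<bar> powr p) \<partial>lborel) = ennreal N"
    and D: "0 \<le> D" "shift_energy p (half_space k 1) u h \<le> ennreal D"
  shows "(\<integral>\<^sup>+x\<in>half_space k 1. ennreal \<bar>\<bar>u (x + h)\<bar> powr p - \<bar>u x\<bar> powr p\<bar> \<partial>lborel)
    \<le> ennreal (2 * p * (D powr (1 / p) * N powr ((p - 1) / p)))"
proof -
  let ?A = "half_space k 1"
  let ?R = "restrict_space lborel ?A"
  let ?d = "\<lambda>x. u (x + h) - u x"
  let ?c = "D powr (1 / p) * N powr ((p - 1) / p)"
  note R = nn_integral_restrict_space[of ?A lborel]
  have R_meas: "f \<in> borel_measurable ?R" if "f \<in> borel_measurable borel" for f :: "real ^ 'n \<Rightarrow> real"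
    using that by (intro measurable_restrict_space1) simp
  \<comment> \<open>As \<open>h $ k\<close> is nonnegative, translation by \<open>h\<close> maps the
    half-space into itself and does not increase the norm.\<close>
  have shift: "(\<integral>\<^sup>+x\<in>?A. ennreal (\<bar>u (x + h)\<bar> powr p) \<partial>lborel) \<le> ennreal N"
  proof -
    have "(\<integral>\<^sup>+x\<in>?A. ennreal (\<bar>u (x + h)\<bar> powr p) \<partial>lborel)
        \<le> (\<integral>\<^sup>+x. ennreal (\<bar>u (x + h)\<bar> powr p) * indicator ?A (x + h) \<partial>lborel)"
      using h by (intro nn_integral_mono) (auto simp: indicator_def half_space_def)
    also have "\<dots> = ennreal N"
      by (subst nn_integral_lborel_translate[where f = "\<lambda>x. ennreal (\<bar>u x\<bar> powr p) * indicator ?A x"]) (auto simp: N)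
    finally show ?thesis .
  qed
  have H: "(\<integral>\<^sup>+x\<in>?A. ennreal (\<bar>?d x\<bar> * \<bar>v x\<bar> powr (p - 1)) \<partial>lborel) \<le> ennreal ?c"
    if [measurable]: "v \<in> borel_measurable borel" and "(\<integral>\<^sup>+x\<in>?A. ennreal (\<bar>v x\<bar> powr p) \<partial>lborel) \<le> ennreal N" for v
  proof -
    have "(\<integral>\<^sup>+x. ennreal (\<bar>?d x\<bar> * \<bar>v x\<bar> powr (p - 1)) \<partial>?R) \<le> ennreal ?c"
    proof (rule nn_integral_Holder_powr)
      show "?d \<in> borel_measurable ?R" "v \<in> borel_measurable ?R"
        by (intro R_meas; measurable)+
    qed (use that(2) p N(1) D in \<open>simp_all add: R shift_energy_def\<close>)
    then show ?thesis
      by (simp add: R)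
  qed
  have "(\<integral>\<^sup>+x\<in>?A. ennreal \<bar>\<bar>u (x + h)\<bar> powr p - \<bar>u x\<bar> powr p\<bar> \<partial>lborel)
      \<le> (\<integral>\<^sup>+x. ennreal p * (ennreal (\<bar>?d x\<bar> * \<bar>u (x + h)\<bar> powr (p - 1)) * indicator ?A x
          + ennreal (\<bar>?d x\<bar> * \<bar>u x\<bar> powr (p - 1)) * indicator ?A x) \<partial>lborel)"
  proof (intro nn_integral_mono)
    fix x
    have "\<bar>\<bar>u (x + h)\<bar> powr p - \<bar>u x\<bar> powr p\<bar>
        \<le> p * \<bar>\<bar>u (x + h)\<bar> - \<bar>u x\<bar>\<bar> * (\<bar>u (x + h)\<bar> powr (p - 1) + \<bar>u x\<bar> powr (p - 1))"
      using p by (intro abs_powr_diff_le) auto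
    also have "\<dots> \<le> p * \<bar>?d x\<bar> * (\<bar>u (x + h)\<bar> powr (p - 1) + \<bar>u x\<bar> powr (p - 1))"
      using p by (intro mult_right_mono mult_left_mono) auto
    finally have "ennreal \<bar>\<bar>u (x + h)\<bar> powr p - \<bar>u x\<bar> powr p\<bar>
        \<le> ennreal p * (ennreal (\<bar>?d x\<bar> * \<bar>u (x + h)\<bar> powr (p - 1)) + ennreal (\<bar>?d x\<bar> * \<bar>u x\<bar> powr (p - 1)))"
      using p by (simp add: distrib_left mult.assoc flip: ennreal_mult' ennreal_plus)
    then show "ennreal \<bar>\<bar>u (x + h)\<bar> powr p - \<bar>u x\<bar> powr p\<bar> * indicator ?A x
      \<le> ennreal p * (ennreal (\<bar>?d x\<bar> * \<bar>u (x + h)\<bar> powr (p - 1)) * indicator ?A x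
          + ennreal (\<bar>?d x\<bar> * \<bar>u x\<bar> powr (p - 1)) * indicator ?A x)"
      by (simp add: indicator_def)
  qed
  also have "\<dots> = ennreal p * ((\<integral>\<^sup>+x\<in>?A. ennreal (\<bar>?d x\<bar> * \<bar>u (x + h)\<bar> powr (p - 1)) \<partial>lborel)
      + (\<integral>\<^sup>+x\<in>?A. ennreal (\<bar>?d x\<bar> * \<bar>u x\<bar> powr (p - 1)) \<partial>lborel))"
    by (subst nn_integral_cmult, measurable) (subst nn_integral_add, auto)
  also have "\<dots> \<le> ennreal p * (ennreal ?c + ennreal ?c)"
    using shift N(2) by (intro mult_left_mono add_mono H) auto
  also have "\<dots> = ennreal (2 * p * ?c)"
    using p by (simp flip: ennreal_mult' ennreal_plus)
  finally show ?thesis .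
qed

section \<open>The norm estimate on the strip of unit width\<close>

lemma step_ball_measure_pos: "0 < measure lborel (step_ball k)"
  unfolding step_ball_def by (simp add: content_ball_pos)

lemma emeasure_step_ball: "emeasure lborel (step_ball k) = ennreal (measure lborel (step_ball k))"
  unfolding step_ball_def using emeasure_lborel_ball_finite
  by (intro emeasure_eq_ennreal_measure) (simp add: less_top)

text \<open>Averaging over \<open>step_ball k\<close>, of measure \<open>m\<close>, gives an
  \<open>h\<close> of shift energy at most \<open>2 * E / m\<close>. The factor \<open>4 * p\<close>
  collects 2 from the two slabs and \<open>2 * p\<close> from the Hoelder bound.\<close>

theorem strip_Lp_le:
  fixes u :: "real ^ 'n \<Rightarrow> real"
  assumes [measurable]: "u \<in> borel_measurable borel" and p: "1 < p"
    and N: "0 \<le> N" "(\<integral>\<^sup>+x\<in>half_space k 1. ennreal (\<bar>u x\<bar> powr p) \<partial>lborel) = ennreal N"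
    and E: "0 \<le> E" "near_energy p 1 (half_space k 1) u \<le> ennreal E"
  shows "(\<integral>\<^sup>+x\<in>strip k 1. ennreal (\<bar>u x\<bar> powr p) \<partial>lborel)
    \<le> ennreal (4 * p * (2 / measure lborel (step_ball k)) powr (1 / p) * (N powr ((p - 1) / p) * E powr (1 / p)))"
proof -
  let ?m = "measure lborel (step_ball k)"
  have "\<exists>h\<in>step_ball k. shift_energy p (half_space k 1) u h \<le> ennreal (2 * E / ?m)"
    using E order_trans[OF nn_integral_shift_energy_le E(2)]
    by (intro exists_le_average[OF _ _ emeasure_step_ball step_ball_measure_pos]) auto
  then obtain h where h: "h \<in> step_ball k" "shift_energy p (half_space k 1) u h \<le> ennreal (2 * E / ?m)"
    by blast
  have "(\<integral>\<^sup>+x\<in>strip k 1. ennreal (\<bar>u x\<bar> powr p) \<partial>lborel)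
      \<le> 2 * (\<integral>\<^sup>+x\<in>half_space k 1. ennreal \<bar>\<bar>u (x + h)\<bar> powr p - \<bar>u x\<bar> powr p\<bar> \<partial>lborel)"
    using step_ballD[OF h(1)] N by (intro strip_integral_le) auto
  also have "\<dots> \<le> 2 * ennreal (2 * p * ((2 * E / ?m) powr (1 / p) * N powr ((p - 1) / p)))"
    using step_ballD[OF h(1)] N E p h(2)
    by (intro mult_left_mono shifted_powr_diff_integral_le) (auto simp: divide_nonneg_nonneg)
  also have "\<dots> = ennreal (2 * (2 * p * ((2 * E / ?m) powr (1 / p) * N powr ((p - 1) / p))))"
    by (metis ennreal_mult' ennreal_numeral zero_le_numeral)
  also have "2 * (2 * p * ((2 * E / ?m) powr (1 / p) * N powr ((p - 1) / p)))
      = 4 * p * (2 / ?m) powr (1 / p) * (N powr ((p - 1) / p) * E powr (1 / p))"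
    using E(1) by (simp add: powr_mult powr_divide)
  finally show ?thesis .
qed

section \<open>Distant pairs of points in the strip\<close>

text \<open>Bounds the overlap of the translates of a unit interval by multiples of
  \<open>c\<close>. Since \<open>2 * c > 1\<close>, each indicator is at most a difference
  \<open>s m - s (m + 2)\<close> of a nonincreasing 0-1 sequence, and these differences
  telescope.\<close>

lemma sum_translated_interval_le:
  fixes c t :: real
  assumes "1 / 2 < c"
  shows "(\<Sum>m<M. of_bool (- 1 < t - real m * c \<and> t - real m * c < 0)) \<le> (2::real)"
proof -
  define s where "s m = (of_bool (real m * c - 1 < t) :: real)" for m
  have "of_bool (- 1 < t - real m * c \<and> t - real m * c < 0) \<le> s m - s (Suc (Suc m))" for m
    using assms by (auto simp: s_def algebra_simps)
  then have "(\<Sum>m<M. of_bool (- 1 < t - real m * c \<and> t - real m * c < 0)) \<le> (\<Sum>m<M. s m - s (Suc (Suc m)))"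
    by (rule sum_mono)
  also have "\<dots> = s 0 + s 1 - s M - s (Suc M)"
    by (induction M) auto
  also have "\<dots> \<le> 2"
    by (simp add: s_def)
  finally show ?thesis .
qed

text \<open>Moving the \<open>m\<close>-th integral to \<open>z = x + real m *\<^sub>R h\<close>
  makes the increment independent of \<open>m\<close> and translates the strip instead. No point
  lies in more than two of the translated strips.\<close>

lemma sum_strip_increments_le:
  fixes u :: "real ^ 'n \<Rightarrow> real"
  assumes [measurable]: "u \<in> borel_measurable borel" and h: "1 / 2 < h $ k"
  shows "(\<Sum>m<M. \<integral>\<^sup>+x\<in>strip k 1. ennreal (\<bar>u (x + real (Suc m) *\<^sub>R h) - u (x + real m *\<^sub>R h)\<bar> powr p) \<partial>lborel)
    \<le> 2 * shift_energy p (half_space k 1) u h"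
proof -
  let ?g = "\<lambda>z. ennreal (\<bar>u (z + h) - u z\<bar> powr p)"
  \<comment> \<open>\<open>?b m z\<close> indicates that \<open>z\<close> lies in the strip
    translated by \<open>real m *\<^sub>R h\<close>, which the coordinate \<open>k\<close> alone
    decides.\<close>
  let ?b = "\<lambda>m z. of_bool (- 1 < z $ k - real m * h $ k \<and> z $ k - real m * h $ k < 0) :: real"
  have "(\<integral>\<^sup>+x\<in>strip k 1. ennreal (\<bar>u (x + real (Suc m) *\<^sub>R h) - u (x + real m *\<^sub>R h)\<bar> powr p) \<partial>lborel)
      \<le> (\<integral>\<^sup>+z\<in>half_space k 1. ?g z * ennreal (?b m z) \<partial>lborel)" for m
  proof -
    have "(\<integral>\<^sup>+x\<in>strip k 1. ennreal (\<bar>u (x + real (Suc m) *\<^sub>R h) - u (x + real m *\<^sub>R h)\<bar> powr p) \<partial>lborel)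
        \<le> (\<integral>\<^sup>+x. ?g (x + real m *\<^sub>R h) * ennreal (?b m (x + real m *\<^sub>R h)) * indicator (half_space k 1) (x + real m *\<^sub>R h) \<partial>lborel)"
    proof (rule nn_integral_mono)
      fix x
      have "0 \<le> real m * h $ k"
        using h by simp
      then show "ennreal (\<bar>u (x + real (Suc m) *\<^sub>R h) - u (x + real m *\<^sub>R h)\<bar> powr p) * indicator (strip k 1) x
        \<le> ?g (x + real m *\<^sub>R h) * ennreal (?b m (x + real m *\<^sub>R h)) * indicator (half_space k 1) (x + real m *\<^sub>R h)"
        by (auto simp: indicator_def strip_def half_space_def scaleR_add_left add_ac)
    qed
    also have "\<dots> = (\<integral>\<^sup>+z\<in>half_space k 1. ?g z * ennreal (?b m z) \<partial>lborel)"
      by (rule nn_integral_lborel_translate) measurable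
    finally show ?thesis .
  qed
  then have "(\<Sum>m<M. \<integral>\<^sup>+x\<in>strip k 1. ennreal (\<bar>u (x + real (Suc m) *\<^sub>R h) - u (x + real m *\<^sub>R h)\<bar> powr p) \<partial>lborel)
      \<le> (\<Sum>m<M. \<integral>\<^sup>+z\<in>half_space k 1. ?g z * ennreal (?b m z) \<partial>lborel)"
    by (rule sum_mono)
  also have "\<dots> = (\<integral>\<^sup>+z. (\<Sum>m<M. ?g z * ennreal (?b m z) * indicator (half_space k 1) z) \<partial>lborel)"
    by (rule nn_integral_sum[symmetric]) measurable
  also have "\<dots> = (\<integral>\<^sup>+z. (\<Sum>m<M. ennreal (?b m z)) * (?g z * indicator (half_space k 1) z) \<partial>lborel)"
    unfolding sum_distrib_right by (intro nn_integral_cong sum.cong refl) (simp only: mult_ac)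
  also have "\<dots> \<le> (\<integral>\<^sup>+z. 2 * (?g z * indicator (half_space k 1) z) \<partial>lborel)"
  proof (intro nn_integral_mono mult_right_mono)
    fix z :: "real ^ 'n"
    have "(\<Sum>m<M. ennreal (?b m z)) = ennreal (\<Sum>m<M. ?b m z)"
      by (rule sum_ennreal) simp
    also have "\<dots> \<le> ennreal 2"
      using h by (intro ennreal_leI sum_translated_interval_le)
    finally show "(\<Sum>m<M. ennreal (?b m z)) \<le> 2"
      by simp
  qed simp
  also have "\<dots> = 2 * shift_energy p (half_space k 1) u h"
    unfolding shift_energy_def by (rule nn_integral_cmult) measurable
  finally show ?thesis .
qed

text \<open>For each \<open>x\<close>, \<open>dyadic_hardy\<close> applies to
  \<open>s m = u (x + real m *\<^sub>R h)\<close>; integrating over the strip leaves the increments,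
  which \<open>sum_strip_increments_le\<close> bounds independently of \<open>N\<close>.\<close>

lemma sum_dyadic_shift_energy_le:
  fixes u :: "real ^ 'n \<Rightarrow> real"
  assumes [measurable]: "u \<in> borel_measurable borel" and p: "1 < p" and h: "1 / 2 < h $ k"
  shows "(\<Sum>j\<le>N. ennreal (2 powr (real j * (1 - p))) * shift_energy p (strip k 1) u (2 ^ j *\<^sub>R h))
    \<le> ennreal (2 * hardy_const p) * shift_energy p (half_space k 1) u h"
proof -
  let ?C = "hardy_const p"
  let ?w = "\<lambda>j. 2 powr (real j * (1 - p)) :: real"
  let ?d = "\<lambda>m x. \<bar>u (x + real (Suc m) *\<^sub>R h) - u (x + real m *\<^sub>R h)\<bar> powr p"
  have C: "0 < ?C"
    using p by (rule hardy_const_pos)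
  have "(\<Sum>j\<le>N. ennreal (?w j) * shift_energy p (strip k 1) u (2 ^ j *\<^sub>R h))
      = (\<integral>\<^sup>+x. (\<Sum>j\<le>N. ennreal (?w j) * (ennreal (\<bar>u (x + 2 ^ j *\<^sub>R h) - u x\<bar> powr p) * indicator (strip k 1) x)) \<partial>lborel)"
    unfolding shift_energy_def
    by (subst nn_integral_sum, measurable, intro sum.cong refl nn_integral_cmult[symmetric]) measurable
  also have "\<dots> \<le> (\<integral>\<^sup>+x. ennreal ?C * (\<Sum>m<2^N. ennreal (?d m x) * indicator (strip k 1) x) \<partial>lborel)"
  proof (rule nn_integral_mono)
    fix x
    have "(\<Sum>j\<le>N. ?w j * \<bar>u (x + 2 ^ j *\<^sub>R h) - u x\<bar> powr p) \<le> ?C * (\<Sum>m<2^N. ?d m x)"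
      using dyadic_hardy[OF p, where N = N and s = "\<lambda>m. u (x + real m *\<^sub>R h)"] by simp
    then have "(\<Sum>j\<le>N. ennreal (?w j) * ennreal (\<bar>u (x + 2 ^ j *\<^sub>R h) - u x\<bar> powr p)) \<le> ennreal ?C * (\<Sum>m<2^N. ennreal (?d m x))"
      using C by (simp add: sum_nonneg flip: ennreal_mult')
    then show "(\<Sum>j\<le>N. ennreal (?w j) * (ennreal (\<bar>u (x + 2 ^ j *\<^sub>R h) - u x\<bar> powr p) * indicator (strip k 1) x))
        \<le> ennreal ?C * (\<Sum>m<2^N. ennreal (?d m x) * indicator (strip k 1) x)"
      by (simp add: indicator_def)
  qed
  also have "\<dots> = ennreal ?C * (\<Sum>m<2^N. \<integral>\<^sup>+x\<in>strip k 1. ennreal (?d m x) \<partial>lborel)"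
    by (subst nn_integral_cmult, measurable) (subst nn_integral_sum, auto)
  also have "\<dots> \<le> ennreal ?C * (2 * shift_energy p (half_space k 1) u h)"
    using h by (intro mult_left_mono sum_strip_increments_le) auto
  also have "\<dots> = ennreal (2 * ?C) * shift_energy p (half_space k 1) u h"
    using ennreal_mult'[of 2 ?C] by (simp add: mult_ac)
  finally show ?thesis .
qed

section \<open>Comparing two points through translates at a common scale\<close>

definition avg_shift :: "real \<Rightarrow> 'n::finite \<Rightarrow> (real ^ 'n \<Rightarrow> real) \<Rightarrow> real \<Rightarrow> real ^ 'n \<Rightarrow> ennreal" where
  "avg_shift p k u n x = (\<integral>\<^sup>+h\<in>step_ball k. ennreal (\<bar>u (x + n *\<^sub>R h) - u x\<bar> powr p) \<partial>lborel)"

text \<open>Concentric with \<open>step_ball k\<close> and of half its radius, so that a correction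
  of norm at most \<open>1 / 8\<close> does not leave \<open>step_ball k\<close>.\<close>

definition core_ball :: "'n::finite \<Rightarrow> (real ^ 'n) set" where
  "core_ball k = ball ((3 / 4) *\<^sub>R axis k 1) (1 / 8)"

lemma core_ball_measure_pos: "0 < measure lborel (core_ball k)"
  unfolding core_ball_def by (simp add: content_ball_pos)

lemma emeasure_core_ball: "emeasure lborel (core_ball k) = ennreal (measure lborel (core_ball k))"
  unfolding core_ball_def using emeasure_lborel_ball_finite
  by (intro emeasure_eq_ennreal_measure) (simp add: less_top)

lemma sets_core_ball [measurable]: "core_ball k \<in> sets borel"
  unfolding core_ball_def by simp

lemma core_ball_add_in_step_ball:
  assumes "h \<in> core_ball k" "norm c \<le> 1 / 8"
  shows "h + c \<in> step_ball k"
proof -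
  let ?c = "(3 / 4) *\<^sub>R axis k 1"
  have "norm (h - ?c) < 1 / 8"
    using assms(1) by (simp add: core_ball_def dist_norm norm_minus_commute)
  then have "norm ((h - ?c) + c) < 1 / 4"
    using norm_triangle_ineq[of "h - ?c" c] assms(2) by linarith
  then show ?thesis
    by (simp add: step_ball_def dist_norm norm_minus_commute[of ?c] algebra_simps)
qed

lemma avg_shift_measurable [measurable]:
  assumes [measurable]: "u \<in> borel_measurable borel"
  shows "avg_shift p k u n \<in> borel_measurable borel"
  unfolding avg_shift_def by measurable

text \<open>The points \<open>x\<close> and \<open>y\<close> are compared through \<open>x + n *\<^sub>R h = y + n *\<^sub>R (h + (x - y) /\<^sub>R n)\<close>.\<close>

lemma powr_diff_le_avg_shift:
  fixes u :: "real ^ 'n \<Rightarrow> real"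
  assumes [measurable]: "u \<in> borel_measurable borel" and p: "1 < p" and n: "8 * norm (y - x) < n"
  shows "ennreal (measure lborel (core_ball k) * \<bar>u y - u x\<bar> powr p)
    \<le> ennreal (2 powr (p - 1)) * (avg_shift p k u n x + avg_shift p k u n y)"
proof -
  define c where "c = (1 / n) *\<^sub>R (x - y)"
  have n0: "0 < n"
    using n norm_ge_zero[of "y - x"] by linarith
  \<comment> \<open>The factor 8 in the hypothesis on \<open>n\<close> matches the gap
    \<open>1 / 8\<close> between the radii of \<open>core_ball k\<close> and
    \<open>step_ball k\<close>.\<close>
  have c: "norm c \<le> 1 / 8"
  proof -
    have "norm c = norm (y - x) / n"
      using n0 unfolding c_def by (simp only: norm_scaleR norm_minus_commute[of x y]) simp
    moreover have "norm (y - x) / n \<le> 1 / 8"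
      using n n0 by (simp add: pos_divide_le_eq)
    ultimately show ?thesis
      by simp
  qed
  have xy: "x + n *\<^sub>R h = y + n *\<^sub>R (h + c)" for h
    using n0 by (simp add: c_def scaleR_add_right)
  let ?f = "\<lambda>x h. ennreal (\<bar>u (x + n *\<^sub>R h) - u x\<bar> powr p) * indicator (step_ball k) h"
  have "ennreal (measure lborel (core_ball k) * \<bar>u y - u x\<bar> powr p)
      = (\<integral>\<^sup>+h. ennreal (\<bar>u y - u x\<bar> powr p) * indicator (core_ball k) h \<partial>lborel)"
    by (subst nn_integral_cmult_indicator)
      (auto simp: emeasure_core_ball ennreal_mult' mult.commute)
  \<comment> \<open>For \<open>h\<close> in \<open>core_ball k\<close> both \<open>h\<close> and
    \<open>h + c\<close> lie in \<open>step_ball k\<close>; the two terms are then integrated over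
    all of it, the second after removing the translation by \<open>c\<close>.\<close>
  also have "\<dots> \<le> (\<integral>\<^sup>+h. ennreal (2 powr (p - 1)) * (?f x h + ?f y (h + c)) \<partial>lborel)"
  proof (rule nn_integral_mono)
    fix h
    have "\<bar>u y - u x\<bar> powr p \<le> (\<bar>u (x + n *\<^sub>R h) - u x\<bar> + \<bar>u (y + n *\<^sub>R (h + c)) - u y\<bar>) powr p"
      unfolding xy using p by (intro powr_mono2) auto
    also have "\<dots> \<le> 2 powr (p - 1) * (\<bar>u (x + n *\<^sub>R h) - u x\<bar> powr p + \<bar>u (y + n *\<^sub>R (h + c)) - u y\<bar> powr p)"
      using p by (intro powr_add_le) auto
    finally have le: "ennreal (\<bar>u y - u x\<bar> powr p)
        \<le> ennreal (2 powr (p - 1)) * (ennreal (\<bar>u (x + n *\<^sub>R h) - u x\<bar> powr p) + ennreal (\<bar>u (y + n *\<^sub>R (h + c)) - u y\<bar> powr p))"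
      by (simp flip: ennreal_mult' ennreal_plus)
    show "ennreal (\<bar>u y - u x\<bar> powr p) * indicator (core_ball k) h \<le> ennreal (2 powr (p - 1)) * (?f x h + ?f y (h + c))"
    proof (cases "h \<in> core_ball k")
      case True
      then have "h \<in> step_ball k" "h + c \<in> step_ball k"
        using core_ball_add_in_step_ball[of h k 0] core_ball_add_in_step_ball[of h k c] c by auto
      then show ?thesis
        using le True by simp
    qed simp
  qed
  also have "\<dots> = ennreal (2 powr (p - 1)) * ((\<integral>\<^sup>+h. ?f x h \<partial>lborel) + (\<integral>\<^sup>+h. ?f y (h + c) \<partial>lborel))"
    by (subst nn_integral_cmult, measurable) (subst nn_integral_add, auto)
  also have "(\<integral>\<^sup>+h. ?f y (h + c) \<partial>lborel) = (\<integral>\<^sup>+h. ?f y h \<partial>lborel)"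
    by (rule nn_integral_lborel_translate) measurable
  finally show ?thesis
    by (simp add: avg_shift_def)
qed

text \<open>A box of side 1 in direction \<open>k\<close> and side \<open>2 * r\<close> in the
  others contains the intersection. Having one power of \<open>r\<close> fewer than the dimension is
  what makes the exponent of the dyadic sum \<open>1 - p\<close> instead of
  \<open>2 - p\<close>.\<close>

lemma emeasure_strip_ball_le:
  fixes x :: "real ^ 'n"
  assumes "0 < r"
  shows "emeasure lborel (strip k 1 \<inter> ball x r) \<le> ennreal ((2 * r) ^ (CARD('n) - 1))"
proof -
  define a :: "real ^ 'n" where "a = (\<chi> i. if i = k then - 1 else x $ i - r)"
  define b :: "real ^ 'n" where "b = (\<chi> i. if i = k then 0 else x $ i + r)"
  have "strip k 1 \<inter> ball x r \<subseteq> cbox a b"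
  proof
    fix y assume y: "y \<in> strip k 1 \<inter> ball x r"
    have "x $ i - r \<le> y $ i \<and> y $ i \<le> x $ i + r" for i
    proof -
      have "norm (y - x) < r"
        using y by (simp add: dist_norm norm_minus_commute)
      then have "\<bar>y $ i - x $ i\<bar> < r"
        using component_le_norm_cart[of "y - x" i] by simp
      then show ?thesis
        by linarith
    qed
    then show "y \<in> cbox a b"
      using y by (auto simp: mem_box_cart a_def b_def strip_def)
  qed
  then have "emeasure lborel (strip k 1 \<inter> ball x r) \<le> emeasure lborel (cbox a b)"
    by (intro emeasure_mono) auto
  also have "\<dots> = ennreal (measure lborel (cbox a b))"
    by (intro emeasure_eq_ennreal_measure) (use emeasure_lborel_cbox_finite[of a b] in \<open>simp add: less_top\<close>)
  also have "measure lborel (cbox a b) = (\<Prod>i\<in>UNIV. b $ i - a $ i)"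
  proof (rule content_cbox_cart)
    have "a \<in> cbox a b"
      using assms by (auto simp: mem_box_cart a_def b_def)
    then show "cbox a b \<noteq> {}"
      by blast
  qed
  also have "\<dots> = (\<Prod>i\<in>UNIV - {k}. 2 * r)"
    by (subst prod.remove[of _ k]) (auto simp: a_def b_def intro!: prod.cong)
  also have "\<dots> = (2 * r) ^ (CARD('n) - 1)"
    by (simp add: card_Diff_singleton)
  finally show ?thesis .
qed

text \<open>The pairs of \<open>T_semi_pow\<close> at distance at least \<open>\<delta>\<close>,
  without the factor \<open>\<delta> powr - 2\<close> that \<open>T_weight_far\<close> splits
  off.\<close>

definition far_energy :: "real \<Rightarrow> real \<Rightarrow> 'a::euclidean_space set \<Rightarrow> ('a \<Rightarrow> real) \<Rightarrow> ennreal" where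
  "far_energy p \<delta> V u = (\<integral>\<^sup>+x\<in>V. (\<integral>\<^sup>+y\<in>V. (if \<delta> \<le> norm (y - x)
     then ennreal (\<bar>u y - u x\<bar> powr p / norm (y - x) powr (real DIM('a) + p - 2)) else 0) \<partial>lborel) \<partial>lborel)"

text \<open>The least \<open>j\<close> with \<open>r < 2 ^ j\<close> is positive because
  \<open>1 \<le> r\<close>, and its predecessor gives the second bound.\<close>

lemma exists_dyadic_scale:
  fixes r :: real
  assumes "1 \<le> r"
  shows "\<exists>j::nat. r < 2 ^ j \<and> 2 ^ j \<le> 2 * r"
proof -
  define j where "j = (LEAST j::nat. r < 2 ^ j)"
  have "\<exists>j::nat. r < 2 ^ j"
    by (intro real_arch_pow) simp
  then have j: "r < 2 ^ j"
    unfolding j_def by (rule LeastI_ex)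
  have "j \<noteq> 0"
    using j assms by (intro notI) simp
  then obtain i where i: "j = Suc i"
    using not0_implies_Suc by blast
  then have "\<not> r < 2 ^ i"
    using not_less_Least[of i "\<lambda>j. r < 2 ^ j"] by (simp add: j_def)
  with i j show ?thesis
    by (intro exI[of _ j]) simp
qed

text \<open>Exchanging \<open>x\<close> and \<open>y\<close> maps one summand to the other, hence
  the factor 2. For fixed \<open>x\<close> the point \<open>y\<close> ranges over the part of the
  strip in \<open>ball x (n / 8)\<close>, and exchanging integrals turns the integral of
  \<open>avg_shift\<close> into one over \<open>h\<close>.\<close>

lemma strip_avg_shift_pairs_le:
  fixes u :: "real ^ 'n \<Rightarrow> real"
  assumes [measurable]: "u \<in> borel_measurable borel" and n: "0 < n"
  shows "(\<integral>\<^sup>+x\<in>strip k 1. (\<integral>\<^sup>+y\<in>strip k 1. (if 8 * norm (y - x) < n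
       then avg_shift p k u n x + avg_shift p k u n y else 0) \<partial>lborel) \<partial>lborel)
    \<le> ennreal (2 * n ^ (CARD('n) - 1)) * (\<integral>\<^sup>+h\<in>step_ball k. shift_energy p (strip k 1) u (n *\<^sub>R h) \<partial>lborel)"
proof -
  let ?V = "strip k 1" and ?\<Phi> = "avg_shift p k u n"
  let ?b = "\<lambda>x y. (if 8 * norm (y - x) < n then 1 else 0) :: ennreal"
  let ?I = "\<integral>\<^sup>+x. (\<integral>\<^sup>+y. ?b x y * ?\<Phi> x * indicator ?V y * indicator ?V x \<partial>lborel) \<partial>lborel"
  have sym: "(\<integral>\<^sup>+x. (\<integral>\<^sup>+y. ?b x y * ?\<Phi> y * indicator ?V y * indicator ?V x \<partial>lborel) \<partial>lborel) = ?I"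
    by (subst lborel_pair.Fubini', measurable) (simp add: norm_minus_commute mult_ac)
  have "?I \<le> (\<integral>\<^sup>+x. ennreal (n ^ (CARD('n) - 1)) * (?\<Phi> x * indicator ?V x) \<partial>lborel)"
  proof (rule nn_integral_mono)
    fix x :: "real ^ 'n"
    have "(\<integral>\<^sup>+y. ?b x y * ?\<Phi> x * indicator ?V y * indicator ?V x \<partial>lborel)
        = (\<integral>\<^sup>+y. (?\<Phi> x * indicator ?V x) * indicator (?V \<inter> ball x (n / 8)) y \<partial>lborel)"
      by (intro nn_integral_cong) (auto simp: indicator_def dist_norm norm_minus_commute)
    also have "\<dots> = (?\<Phi> x * indicator ?V x) * emeasure lborel (?V \<inter> ball x (n / 8))"
      by (rule nn_integral_cmult_indicator) measurable
    also have "\<dots> \<le> (?\<Phi> x * indicator ?V x) * ennreal ((2 * (n / 8)) ^ (CARD('n) - 1))"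
      using n by (intro mult_left_mono emeasure_strip_ball_le) auto
    also have "\<dots> \<le> (?\<Phi> x * indicator ?V x) * ennreal (n ^ (CARD('n) - 1))"
      using n by (intro mult_left_mono ennreal_leI power_mono) auto
    finally show "(\<integral>\<^sup>+y. ?b x y * ?\<Phi> x * indicator ?V y * indicator ?V x \<partial>lborel)
      \<le> ennreal (n ^ (CARD('n) - 1)) * (?\<Phi> x * indicator ?V x)"
      by (simp add: mult.commute)
  qed
  also have "(\<integral>\<^sup>+x. ennreal (n ^ (CARD('n) - 1)) * (?\<Phi> x * indicator ?V x) \<partial>lborel)
      = ennreal (n ^ (CARD('n) - 1)) * (\<integral>\<^sup>+x\<in>?V. ?\<Phi> x \<partial>lborel)"
    by (rule nn_integral_cmult) measurable
  also have "(\<integral>\<^sup>+x\<in>?V. ?\<Phi> x \<partial>lborel)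
      = (\<integral>\<^sup>+x. (\<integral>\<^sup>+h. ennreal (\<bar>u (x + n *\<^sub>R h) - u x\<bar> powr p) * indicator (step_ball k) h * indicator ?V x \<partial>lborel) \<partial>lborel)"
    unfolding avg_shift_def by (subst nn_integral_multc) auto
  also have "\<dots> = (\<integral>\<^sup>+h. (\<integral>\<^sup>+x. ennreal (\<bar>u (x + n *\<^sub>R h) - u x\<bar> powr p) * indicator ?V x * indicator (step_ball k) h \<partial>lborel) \<partial>lborel)"
    by (subst lborel_pair.Fubini', measurable) (simp add: mult_ac)
  also have "\<dots> = (\<integral>\<^sup>+h\<in>step_ball k. shift_energy p ?V u (n *\<^sub>R h) \<partial>lborel)"
    unfolding shift_energy_def by (subst nn_integral_multc) auto
  finally have I_le: "?I \<le> ennreal (n ^ (CARD('n) - 1)) * (\<integral>\<^sup>+h\<in>step_ball k. shift_energy p ?V u (n *\<^sub>R h) \<partial>lborel)" .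
  have "(\<integral>\<^sup>+x\<in>?V. (\<integral>\<^sup>+y\<in>?V. (if 8 * norm (y - x) < n then ?\<Phi> x + ?\<Phi> y else 0) \<partial>lborel) \<partial>lborel)
      = (\<integral>\<^sup>+x. (\<integral>\<^sup>+y. ?b x y * ?\<Phi> x * indicator ?V y * indicator ?V x
          + ?b x y * ?\<Phi> y * indicator ?V y * indicator ?V x \<partial>lborel) \<partial>lborel)"
    by (subst nn_integral_multc[symmetric], measurable) (intro nn_integral_cong, simp add: distrib_right)
  also have "\<dots> = ?I + ?I"
    by (subst nn_integral_add, measurable) (subst nn_integral_add, measurable, simp add: sym)
  also have "?I + ?I \<le> 2 * (ennreal (n ^ (CARD('n) - 1)) * (\<integral>\<^sup>+h\<in>step_ball k. shift_energy p ?V u (n *\<^sub>R h) \<partial>lborel))"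
    unfolding mult_2 by (intro add_mono I_le)
  finally show ?thesis
    using n by (simp add: ennreal_mult' mult.assoc)
qed

lemma nn_set_integral_suminf_cmult:
  fixes f :: "nat \<Rightarrow> 'a \<Rightarrow> ennreal"
  assumes [measurable]: "\<And>j. f j \<in> borel_measurable M" "V \<in> sets M"
  shows "(\<integral>\<^sup>+x\<in>V. K * (\<Sum>j. w j * f j x) \<partial>M) = K * (\<Sum>j. w j * (\<integral>\<^sup>+x\<in>V. f j x \<partial>M))"
proof -
  have "(\<integral>\<^sup>+x\<in>V. K * (\<Sum>j. w j * f j x) \<partial>M) = (\<integral>\<^sup>+x. K * (\<Sum>j. w j * (f j x * indicator V x)) \<partial>M)"
    by (intro nn_integral_cong) (simp add: indicator_def)
  also have "\<dots> = K * (\<integral>\<^sup>+x. (\<Sum>j. w j * (f j x * indicator V x)) \<partial>M)"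
    by (rule nn_integral_cmult) measurable
  also have "\<dots> = K * (\<Sum>j. \<integral>\<^sup>+x. w j * (f j x * indicator V x) \<partial>M)"
    by (subst nn_integral_suminf) auto
  also have "\<dots> = K * (\<Sum>j. w j * (\<integral>\<^sup>+x\<in>V. f j x \<partial>M))"
    by (subst nn_integral_cmult) auto
  finally show ?thesis .
qed

text \<open>Each pair at distance at least 1 is bounded at one suitable scale \<open>2 ^ j\<close>.
  Summing over all scales avoids a choice of \<open>j\<close> that depends on the pair.\<close>

lemma strip_far_energy_le_suminf:
  fixes u :: "real ^ 'n \<Rightarrow> real"
  assumes [measurable]: "u \<in> borel_measurable borel" and p: "1 < p"
  shows "far_energy p 1 (strip k 1) u
    \<le> ennreal (2 powr (p - 1) / measure lborel (core_ball k)) *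
      (\<Sum>j. ennreal ((2 ^ j / 16) powr - (real CARD('n) + p - 2)) *
        (\<integral>\<^sup>+x\<in>strip k 1. (\<integral>\<^sup>+y\<in>strip k 1. (if 8 * norm (y - x) < 2 ^ j
          then avg_shift p k u (2 ^ j) x + avg_shift p k u (2 ^ j) y else 0) \<partial>lborel) \<partial>lborel))"
proof -
  let ?V = "strip k 1" and ?\<Phi> = "\<lambda>j. avg_shift p k u (2 ^ j)"
  let ?m = "measure lborel (core_ball k)" and ?e = "real CARD('n) + p - 2"
  let ?w = "\<lambda>j::nat. ennreal ((2 ^ j / 16) powr - ?e)"
  let ?K = "ennreal (2 powr (p - 1) / ?m)"
  let ?s = "\<lambda>j x y. if 8 * norm (y - x) < 2 ^ j then ?\<Phi> j x + ?\<Phi> j y else 0"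
  have m: "0 < ?m"
    by (rule core_ball_measure_pos)
  have "1 \<le> CARD('n)"
    by (simp add: Suc_le_eq)
  then have e: "0 \<le> ?e"
    using p by linarith
  have dim: "DIM(real ^ 'n) = CARD('n)"
    by simp
  have pw: "(if 1 \<le> norm (y - x) then ennreal (\<bar>u y - u x\<bar> powr p / norm (y - x) powr ?e) else 0)
      \<le> ?K * (\<Sum>j. ?w j * ?s j x y)" for x y
  proof (cases "1 \<le> norm (y - x)")
    case True
    \<comment> \<open>At this scale \<open>norm (y - x)\<close> lies between
      \<open>2 ^ j / 16\<close> and \<open>2 ^ j / 8\<close>: the upper bound serves the comparison
      of the two points, the lower one the weight.\<close>
    obtain j :: nat where j: "8 * norm (y - x) < 2 ^ j" "2 ^ j \<le> 2 * (8 * norm (y - x))"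
      using exists_dyadic_scale[of "8 * norm (y - x)"] True by auto
    have "inverse (norm (y - x) powr ?e) \<le> inverse ((2 ^ j / 16) powr ?e)"
      using j e by (intro le_imp_inverse_le powr_mono2) auto
    then have "\<bar>u y - u x\<bar> powr p / norm (y - x) powr ?e \<le> (2 ^ j / 16) powr - ?e * \<bar>u y - u x\<bar> powr p"
      unfolding powr_minus divide_inverse[of "\<bar>u y - u x\<bar> powr p"]
      by (subst mult.commute, intro mult_right_mono) auto
    then have "ennreal (\<bar>u y - u x\<bar> powr p / norm (y - x) powr ?e) \<le> ?w j * ennreal (\<bar>u y - u x\<bar> powr p)"
      by (simp flip: ennreal_mult')
    also have "ennreal (\<bar>u y - u x\<bar> powr p) = ennreal (1 / ?m) * ennreal (?m * \<bar>u y - u x\<bar> powr p)"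
      using m by (simp flip: ennreal_mult')
    also have "ennreal (?m * \<bar>u y - u x\<bar> powr p) \<le> ennreal (2 powr (p - 1)) * (?\<Phi> j x + ?\<Phi> j y)"
      using p j(1) by (intro powr_diff_le_avg_shift) auto
    also have "?w j * (ennreal (1 / ?m) * (ennreal (2 powr (p - 1)) * (?\<Phi> j x + ?\<Phi> j y))) = ?K * (?w j * ?s j x y)"
    proof -
      have "?K = ennreal (1 / ?m) * ennreal (2 powr (p - 1))"
        using m by (simp flip: ennreal_mult')
      then show ?thesis
        using j(1) by (simp only: if_True mult_ac)
    qed
    also have "\<dots> \<le> ?K * (\<Sum>j. ?w j * ?s j x y)"
      using sum_le_suminf[OF summableI, of "{j}" "\<lambda>j. ?w j * ?s j x y"] by (intro mult_left_mono) simp_all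
    finally show ?thesis
      using True by (simp add: mult_left_mono)
  qed simp
  have "far_energy p 1 ?V u \<le> (\<integral>\<^sup>+x\<in>?V. (\<integral>\<^sup>+y\<in>?V. ?K * (\<Sum>j. ?w j * ?s j x y) \<partial>lborel) \<partial>lborel)"
    unfolding far_energy_def dim by (intro nn_integral_mono mult_right_mono pw) auto
  also have "\<dots> = (\<integral>\<^sup>+x\<in>?V. ?K * (\<Sum>j. ?w j * (\<integral>\<^sup>+y\<in>?V. ?s j x y \<partial>lborel)) \<partial>lborel)"
    by (subst nn_set_integral_suminf_cmult) auto
  also have "\<dots> = ?K * (\<Sum>j. ?w j * (\<integral>\<^sup>+x\<in>?V. (\<integral>\<^sup>+y\<in>?V. ?s j x y \<partial>lborel) \<partial>lborel))"
    by (rule nn_set_integral_suminf_cmult) auto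
  finally show ?thesis .
qed

text \<open>The three factors stem from the comparison of two points, from the dyadic weights with
  the measure of the pairs, and from the Hardy inequality.\<close>

definition far_const :: "real \<Rightarrow> 'n::finite \<Rightarrow> real" where
  "far_const p k = 2 powr (p - 1) / measure lborel (core_ball k) *
     (2 * 16 powr (real CARD('n) + p - 2)) * (2 * hardy_const p)"

lemma far_const_nonneg: "1 < p \<Longrightarrow> 0 \<le> far_const p k"
  using hardy_const_pos[of p] by (simp add: far_const_def)

theorem strip_far_energy_le:
  fixes u :: "real ^ 'n \<Rightarrow> real"
  assumes [measurable]: "u \<in> borel_measurable borel" and p: "1 < p"
  shows "far_energy p 1 (strip k 1) u \<le> ennreal (far_const p k) * near_energy p 1 (half_space k 1) u"
proof -
  let ?V = "strip k 1" and ?A = "half_space k 1"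
  let ?e = "real CARD('n) + p - 2"
  let ?K = "2 powr (p - 1) / measure lborel (core_ball k)"
  let ?w = "\<lambda>j::nat. (2 ^ j / 16) powr - ?e"
  let ?J = "\<lambda>j::nat. \<integral>\<^sup>+h\<in>step_ball k. shift_energy p ?V u (2 ^ j *\<^sub>R h) \<partial>lborel"
  let ?c = "2 * 16 powr ?e"
  \<comment> \<open>The exponents \<open>- ?e\<close> of the weight and \<open>CARD('n) - 1\<close>
    of the measure bound add up to \<open>1 - p\<close>, the exponent of the Hardy weight; the 16
    goes into the constant.\<close>
  have weight: "?w j * (2 * (2 ^ j) ^ (CARD('n) - 1)) = ?c * 2 powr (real j * (1 - p))" for j :: nat
  proof -
    have "real (CARD('n) - 1) = real CARD('n) - 1"
      by (simp add: of_nat_diff Suc_le_eq)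
    then have w1: "((2::real) ^ j) ^ (CARD('n) - 1) = 2 powr (real j * (real CARD('n) - 1))"
      by (simp add: powr_powr powr_realpow[symmetric])
    have w2: "(2 ^ j / 16) powr - e = 2 powr (real j * - e) * 16 powr e" for e :: real
      by (simp add: powr_divide powr_powr powr_minus field_simps flip: powr_realpow)
    have w3: "2 powr (real j * - ?e) * 2 powr (real j * (real CARD('n) - 1)) = 2 powr (real j * (1 - p))"
      by (simp add: algebra_simps flip: powr_add)
    have "?w j * (2 * (2 ^ j) ^ (CARD('n) - 1)) = ?c * (2 powr (real j * - ?e) * (2 ^ j) ^ (CARD('n) - 1))"
      unfolding w2 by (simp only: mult_ac)
    then show ?thesis
      unfolding w1 w3 .
  qed
  \<comment> \<open>The Hardy bound has the same constant for every \<open>h\<close> and every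
    partial sum, so it passes to the series and then to the integral over
    \<open>step_ball k\<close>, which the near energy bounds.\<close>
  have hardy: "(\<Sum>j. ennreal (2 powr (real j * (1 - p))) * ?J j) \<le> ennreal (2 * hardy_const p) * near_energy p 1 ?A u"
  proof -
    have [measurable]: "(\<lambda>h. shift_energy p ?V u (2 ^ j *\<^sub>R h)) \<in> borel_measurable lborel" for j :: nat
      by measurable
    have partial: "(\<Sum>j<N. ennreal (2 powr (real j * (1 - p))) * shift_energy p ?V u (2 ^ j *\<^sub>R h))
        \<le> ennreal (2 * hardy_const p) * shift_energy p ?A u h" if "h \<in> step_ball k" for N h
    proof -
      have "(\<Sum>j<N. ennreal (2 powr (real j * (1 - p))) * shift_energy p ?V u (2 ^ j *\<^sub>R h))
          \<le> (\<Sum>j\<le>N. ennreal (2 powr (real j * (1 - p))) * shift_energy p ?V u (2 ^ j *\<^sub>R h))"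
        by (intro sum_mono2) auto
      also have "\<dots> \<le> ennreal (2 * hardy_const p) * shift_energy p ?A u h"
        using p step_ballD[OF that] by (intro sum_dyadic_shift_energy_le) auto
      finally show ?thesis .
    qed
    have "(\<Sum>j. ennreal (2 powr (real j * (1 - p))) * ?J j)
        = (\<integral>\<^sup>+h\<in>step_ball k. 1 * (\<Sum>j. ennreal (2 powr (real j * (1 - p))) * shift_energy p ?V u (2 ^ j *\<^sub>R h)) \<partial>lborel)"
      by (subst nn_set_integral_suminf_cmult) auto
    also have "\<dots> \<le> (\<integral>\<^sup>+h. ennreal (2 * hardy_const p) * (shift_energy p ?A u h * indicator (step_ball k) h) \<partial>lborel)"
      using partial by (intro nn_integral_mono) (auto simp: indicator_def intro!: suminf_le_const summableI)
    also have "\<dots> = ennreal (2 * hardy_const p) * (\<integral>\<^sup>+h\<in>step_ball k. shift_energy p ?A u h \<partial>lborel)"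
      by (rule nn_integral_cmult) measurable
    also have "\<dots> \<le> ennreal (2 * hardy_const p) * near_energy p 1 ?A u"
      by (intro mult_left_mono nn_integral_shift_energy_le) auto
    finally show ?thesis .
  qed
  have "far_energy p 1 ?V u \<le> ennreal ?K * (\<Sum>j. ennreal (?w j) *
      (\<integral>\<^sup>+x\<in>?V. (\<integral>\<^sup>+y\<in>?V. (if 8 * norm (y - x) < 2 ^ j
        then avg_shift p k u (2 ^ j) x + avg_shift p k u (2 ^ j) y else 0) \<partial>lborel) \<partial>lborel))"
    using p by (intro strip_far_energy_le_suminf) auto
  also have "\<dots> \<le> ennreal ?K * (\<Sum>j. ennreal ?c * (ennreal (2 powr (real j * (1 - p))) * ?J j))"
  proof (intro mult_left_mono suminf_le summableI)
    fix j :: nat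
    have "ennreal (?w j) * (\<integral>\<^sup>+x\<in>?V. (\<integral>\<^sup>+y\<in>?V. (if 8 * norm (y - x) < 2 ^ j
          then avg_shift p k u (2 ^ j) x + avg_shift p k u (2 ^ j) y else 0) \<partial>lborel) \<partial>lborel)
        \<le> ennreal (?w j) * (ennreal (2 * (2 ^ j) ^ (CARD('n) - 1)) * ?J j)"
      by (intro mult_left_mono strip_avg_shift_pairs_le) auto
    also have "\<dots> = ennreal (?w j * (2 * (2 ^ j) ^ (CARD('n) - 1))) * ?J j"
      by (subst ennreal_mult') (auto simp: mult.assoc)
    also have "\<dots> = ennreal ?c * (ennreal (2 powr (real j * (1 - p))) * ?J j)"
      unfolding weight by (subst ennreal_mult') (auto simp: mult.assoc)
    finally show "ennreal (?w j) * (\<integral>\<^sup>+x\<in>?V. (\<integral>\<^sup>+y\<in>?V. (if 8 * norm (y - x) < 2 ^ j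
          then avg_shift p k u (2 ^ j) x + avg_shift p k u (2 ^ j) y else 0) \<partial>lborel) \<partial>lborel)
        \<le> ennreal ?c * (ennreal (2 powr (real j * (1 - p))) * ?J j)" .
  qed simp
  also have "\<dots> = ennreal ?K * (ennreal ?c * (\<Sum>j. ennreal (2 powr (real j * (1 - p))) * ?J j))"
    by simp
  also have "\<dots> \<le> ennreal ?K * (ennreal ?c * (ennreal (2 * hardy_const p) * near_energy p 1 ?A u))"
    by (intro mult_left_mono hardy) auto
  also have "\<dots> = ennreal (far_const p k) * near_energy p 1 ?A u"
  proof -
    have mult3: "ennreal (a * b * c) = ennreal a * ennreal b * ennreal c" if "0 \<le> a" "0 \<le> b" for a b c :: real
      using that by (simp add: ennreal_mult')
    have "ennreal (far_const p k) = ennreal ?K * ennreal ?c * ennreal (2 * hardy_const p)"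
      unfolding far_const_def by (rule mult3) simp_all
    then show ?thesis
      by (simp add: mult.assoc)
  qed
  finally show ?thesis .
qed

section \<open>Passage to general horizon\<close>

text \<open>\<open>F\<close> takes the values of the function as separate arguments, so that one
  rule serves \<open>S_semi_pow\<close> and \<open>T_semi_pow\<close>. As \<open>W\<close> may be
  smaller than \<open>U\<close>, one representative on the half-space also serves the strip.\<close>

lemma nn_integral_pair_lebesgue_on:
  fixes u v :: "'a::euclidean_space \<Rightarrow> real"
  assumes W: "W \<in> sets borel" "W \<subseteq> U" and ae: "AE x in lborel. x \<in> U \<longrightarrow> u x = v x"
  shows "(\<integral>\<^sup>+x. (\<integral>\<^sup>+y. F x y (u x) (u y) \<partial>lebesgue_on W) \<partial>lebesgue_on W)
    = (\<integral>\<^sup>+x\<in>W. (\<integral>\<^sup>+y\<in>W. F x y (v x) (v y) \<partial>lborel) \<partial>lborel)"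
  unfolding nn_integral_lebesgue_on[OF W(1)]
proof (rule nn_integral_cong_AE, use ae in eventually_elim)
  case (elim x)
  have "(\<integral>\<^sup>+y\<in>W. F x y (v x) (u y) \<partial>lborel) = (\<integral>\<^sup>+y\<in>W. F x y (v x) (v y) \<partial>lborel)"
    by (rule nn_integral_cong_AE, use ae in eventually_elim) (use W(2) in \<open>auto simp: indicator_def\<close>)
  then show ?case
    using elim W(2) by (auto simp: indicator_def)
qed

lemma Lp_pow_representative:
  fixes u v :: "'a::euclidean_space \<Rightarrow> real"
  assumes W: "W \<in> sets borel" "W \<subseteq> U" and ae: "AE x in lborel. x \<in> U \<longrightarrow> u x = v x"
  shows "Lp_pow p W u = (\<integral>\<^sup>+x\<in>W. ennreal (\<bar>v x\<bar> powr p) \<partial>lborel)"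
  unfolding Lp_pow_def nn_integral_lebesgue_on[OF W(1)]
  by (rule nn_integral_cong_AE, use ae in eventually_elim) (use W(2) in \<open>auto simp: indicator_def\<close>)

lemma nn_integral_pair_scaleR:
  fixes F :: "'a::euclidean_space \<Rightarrow> 'a \<Rightarrow> ennreal"
  assumes F[measurable]: "(\<lambda>(x, y). F x y) \<in> borel_measurable (lborel \<Otimes>\<^sub>M lborel)" and c: "0 < c"
  shows "(\<integral>\<^sup>+x. (\<integral>\<^sup>+y. F x y \<partial>lborel) \<partial>lborel)
    = ennreal (c powr (2 * real DIM('a))) * (\<integral>\<^sup>+x. (\<integral>\<^sup>+y. F (c *\<^sub>R x) (c *\<^sub>R y) \<partial>lborel) \<partial>lborel)"
proof -
  have [measurable]: "F x \<in> borel_measurable borel" for x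
    using measurable_compose_Pair1[OF _ F, of x] by simp
  have [measurable]: "(\<lambda>x. \<integral>\<^sup>+y. F (c *\<^sub>R x) (c *\<^sub>R y) \<partial>lborel) \<in> borel_measurable lborel"
    using F by measurable
  have "(\<integral>\<^sup>+x. (\<integral>\<^sup>+y. F x y \<partial>lborel) \<partial>lborel)
      = (\<integral>\<^sup>+x. ennreal (c ^ DIM('a)) * (\<integral>\<^sup>+y. F x (c *\<^sub>R y) \<partial>lborel) \<partial>lborel)"
    using c by (subst nn_integral_lborel_scaleR[of "F _" c]) auto
  also have "\<dots> = ennreal (c ^ DIM('a)) * (\<integral>\<^sup>+x. ennreal (c ^ DIM('a)) * (\<integral>\<^sup>+y. F (c *\<^sub>R x) (c *\<^sub>R y) \<partial>lborel) \<partial>lborel)"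
    using F c by (intro nn_integral_lborel_scaleR) measurable
  also have "\<dots> = ennreal (c ^ DIM('a)) * (ennreal (c ^ DIM('a)) * (\<integral>\<^sup>+x. (\<integral>\<^sup>+y. F (c *\<^sub>R x) (c *\<^sub>R y) \<partial>lborel) \<partial>lborel))"
    by (subst nn_integral_cmult) auto
  also have "\<dots> = ennreal (c ^ DIM('a) * c ^ DIM('a)) * (\<integral>\<^sup>+x. (\<integral>\<^sup>+y. F (c *\<^sub>R x) (c *\<^sub>R y) \<partial>lborel) \<partial>lborel)"
    using c by (simp add: ennreal_mult' mult.assoc)
  also have "c ^ DIM('a) * c ^ DIM('a) = c powr (2 * real DIM('a))"
    using c by (simp only: mult_2 powr_add powr_realpow)
  finally show ?thesis .
qed

section \<open>Dilation from \<open>\<delta>\<close> to 1\<close>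

lemma indicator_scaled:
  assumes "0 < \<delta>"
  shows "indicator (half_space k \<delta>) (\<delta> *\<^sub>R x) = indicator (half_space k 1) x"
    and "indicator (strip k \<delta>) (\<delta> *\<^sub>R x) = indicator (strip k 1) x"
proof -
  have "- \<delta> < \<delta> * (x $ k) \<longleftrightarrow> - 1 < x $ k"
    using assms mult_less_cancel_left_pos[of \<delta> "- 1" "x $ k"] by simp
  moreover have "\<delta> * (x $ k) < 0 \<longleftrightarrow> x $ k < 0"
    using assms by (simp add: mult_less_0_iff)
  ultimately show "indicator (half_space k \<delta>) (\<delta> *\<^sub>R x) = indicator (half_space k 1) x"
    "indicator (strip k \<delta>) (\<delta> *\<^sub>R x) = indicator (strip k 1) x"
    by (simp_all add: indicator_def half_space_def strip_def)
qed

lemma Lp_scaled: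
  fixes v :: "real ^ 'n \<Rightarrow> real"
  assumes [measurable]: "v \<in> borel_measurable borel" and \<delta>: "0 < \<delta>"
  shows "(\<integral>\<^sup>+x\<in>half_space k \<delta>. ennreal (\<bar>v x\<bar> powr p) \<partial>lborel)
      = ennreal (\<delta> powr real CARD('n)) * (\<integral>\<^sup>+x\<in>half_space k 1. ennreal (\<bar>v (\<delta> *\<^sub>R x)\<bar> powr p) \<partial>lborel)"
    and "(\<integral>\<^sup>+x\<in>strip k \<delta>. ennreal (\<bar>v x\<bar> powr p) \<partial>lborel)
      = ennreal (\<delta> powr real CARD('n)) * (\<integral>\<^sup>+x\<in>strip k 1. ennreal (\<bar>v (\<delta> *\<^sub>R x)\<bar> powr p) \<partial>lborel)"
  using \<delta> by (subst nn_integral_lborel_scaleR[of _ \<delta>];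
      simp add: powr_realpow indicator_scaled)+

lemma norm_scaleR_diff:
  fixes x y :: "'a::real_normed_vector"
  assumes "0 < \<delta>"
  shows "norm (\<delta> *\<^sub>R y - \<delta> *\<^sub>R x) = \<delta> * norm (y - x)"
  using assms by (simp flip: scaleR_diff_right)

lemma near_energy_scaled:
  fixes v :: "real ^ 'n \<Rightarrow> real"
  assumes [measurable]: "v \<in> borel_measurable borel" and \<delta>: "0 < \<delta>"
  shows "near_energy p \<delta> (half_space k \<delta>) v
    = ennreal (\<delta> powr (2 * real CARD('n))) * near_energy p 1 (half_space k 1) (\<lambda>x. v (\<delta> *\<^sub>R x))"
proof -
  let ?F = "\<lambda>x y. (if norm (y - x) < \<delta> then ennreal (\<bar>v y - v x\<bar> powr p) else 0)
    * indicator (half_space k \<delta>) y * indicator (half_space k \<delta>) x"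
  have dim: "DIM(real ^ 'n) = CARD('n)"
    by simp
  have "near_energy p \<delta> (half_space k \<delta>) v = (\<integral>\<^sup>+x. (\<integral>\<^sup>+y. ?F x y \<partial>lborel) \<partial>lborel)"
    unfolding near_energy_def by (subst nn_integral_multc) auto
  also have "\<dots> = ennreal (\<delta> powr (2 * real CARD('n))) * (\<integral>\<^sup>+x. (\<integral>\<^sup>+y. ?F (\<delta> *\<^sub>R x) (\<delta> *\<^sub>R y) \<partial>lborel) \<partial>lborel)"
    unfolding dim[symmetric] by (rule nn_integral_pair_scaleR) (use \<delta> in measurable)
  also have "(\<integral>\<^sup>+x. (\<integral>\<^sup>+y. ?F (\<delta> *\<^sub>R x) (\<delta> *\<^sub>R y) \<partial>lborel) \<partial>lborel) = near_energy p 1 (half_space k 1) (\<lambda>x. v (\<delta> *\<^sub>R x))"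
    unfolding near_energy_def indicator_scaled[OF \<delta>] norm_scaleR_diff[OF \<delta>]
    using \<delta> by (subst nn_integral_multc) auto
  finally show ?thesis .
qed

text \<open>The two changes of variables give the exponent \<open>2 * CARD('n)\<close>, and the
  weight gives \<open>- (CARD('n) + p - 2)\<close>.\<close>

lemma far_energy_scaled:
  fixes v :: "real ^ 'n \<Rightarrow> real"
  assumes [measurable]: "v \<in> borel_measurable borel" and \<delta>: "0 < \<delta>"
  shows "far_energy p \<delta> (strip k \<delta>) v
    = ennreal (\<delta> powr (real CARD('n) - p + 2)) * far_energy p 1 (strip k 1) (\<lambda>x. v (\<delta> *\<^sub>R x))"
proof -
  let ?e = "real CARD('n) + p - 2"
  let ?G = "\<lambda>\<delta> v x y. if \<delta> \<le> norm (y - x) then ennreal (\<bar>v y - v x\<bar> powr p / norm (y - x) powr ?e) else 0"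
  let ?F = "\<lambda>x y. ?G \<delta> v x y * indicator (strip k \<delta>) y * indicator (strip k \<delta>) x"
  let ?v = "\<lambda>x. v (\<delta> *\<^sub>R x)"
  have dim: "DIM(real ^ 'n) = CARD('n)"
    by simp
  have G: "?G \<delta> v (\<delta> *\<^sub>R x) (\<delta> *\<^sub>R y) = ennreal (\<delta> powr - ?e) * ?G 1 ?v x y" for x y
  proof -
    have "ennreal (a / (\<delta> * r) powr e) = ennreal (\<delta> powr - e) * ennreal (a / r powr e)" if "0 \<le> r" for a r e
      using \<delta> that by (simp add: powr_mult powr_minus divide_inverse mult_ac flip: ennreal_mult')
    from this[of "norm (y - x)" "\<bar>?v y - ?v x\<bar> powr p" ?e] show ?thesis
      using \<delta> by (simp add: norm_scaleR_diff)
  qed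
  have "far_energy p \<delta> (strip k \<delta>) v = (\<integral>\<^sup>+x. (\<integral>\<^sup>+y. ?F x y \<partial>lborel) \<partial>lborel)"
    unfolding far_energy_def dim by (subst nn_integral_multc) auto
  also have "\<dots> = ennreal (\<delta> powr (2 * real CARD('n))) * (\<integral>\<^sup>+x. (\<integral>\<^sup>+y. ?F (\<delta> *\<^sub>R x) (\<delta> *\<^sub>R y) \<partial>lborel) \<partial>lborel)"
    unfolding dim[symmetric] by (rule nn_integral_pair_scaleR) (use \<delta> in measurable)
  also have "(\<integral>\<^sup>+x. (\<integral>\<^sup>+y. ?F (\<delta> *\<^sub>R x) (\<delta> *\<^sub>R y) \<partial>lborel) \<partial>lborel)
      = (\<integral>\<^sup>+x. (\<integral>\<^sup>+y. ennreal (\<delta> powr - ?e) * (?G 1 ?v x y * indicator (strip k 1) y * indicator (strip k 1) x) \<partial>lborel) \<partial>lborel)"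
    unfolding indicator_scaled[OF \<delta>] G mult.assoc ..
  also have "\<dots> = ennreal (\<delta> powr - ?e) * (\<integral>\<^sup>+x. (\<integral>\<^sup>+y. ?G 1 ?v x y * indicator (strip k 1) y * indicator (strip k 1) x \<partial>lborel) \<partial>lborel)"
    by (subst nn_integral_cmult, measurable) (subst nn_integral_cmult, auto)
  also have "(\<integral>\<^sup>+x. (\<integral>\<^sup>+y. ?G 1 ?v x y * indicator (strip k 1) y * indicator (strip k 1) x \<partial>lborel) \<partial>lborel)
      = far_energy p 1 (strip k 1) ?v"
    unfolding far_energy_def dim by (subst nn_integral_multc) auto
  also have "ennreal (\<delta> powr (2 * real CARD('n))) * (ennreal (\<delta> powr - ?e) * far_energy p 1 (strip k 1) ?v)
      = ennreal (\<delta> powr (2 * real CARD('n)) * \<delta> powr - ?e) * far_energy p 1 (strip k 1) ?v"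
    by (simp only: ennreal_mult' powr_ge_zero mult.assoc)
  also have "\<delta> powr (2 * real CARD('n)) * \<delta> powr - ?e = \<delta> powr (real CARD('n) - p + 2)"
    by (simp add: algebra_simps flip: powr_add)
  finally show ?thesis .
qed

section \<open>The kernel and the trace weight against the two energies\<close>

lemma kernel_measurable [measurable]: "kernel d p \<delta> \<beta> \<in> borel_measurable borel"
  unfolding kernel_def by measurable

lemma sphere_area_pos: "0 < d \<Longrightarrow> 0 < sphere_area d"
  unfolding sphere_area_def by simp

text \<open>As \<open>\<beta>\<close> is nonnegative, \<open>r powr - \<beta>\<close> is at least
  \<open>\<delta> powr - \<beta>\<close>. The exponents of \<open>\<delta>\<close> then add up to
  \<open>- (d + p)\<close>, so \<open>\<beta>\<close> remains only in the factor
  \<open>d + p - \<beta>\<close>.\<close>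

lemma kernel_ge:
  assumes "0 < r" "r < \<delta>" "0 \<le> \<beta>" "\<beta> < real d + p" "0 < d"
  shows "(real d + p - \<beta>) / sphere_area d * \<delta> powr - (real d + p) \<le> kernel d p \<delta> \<beta> r"
proof -
  define K where "K = (real d + p - \<beta>) / sphere_area d"
  have K: "0 \<le> K"
    using assms sphere_area_pos[of d] by (simp add: K_def)
  have "\<delta> powr - (real d + p) = \<delta> powr - (real d + p - \<beta>) * \<delta> powr - \<beta>"
    by (simp flip: powr_add)
  also have "\<dots> \<le> \<delta> powr - (real d + p - \<beta>) * r powr - \<beta>"
    using assms by (intro mult_left_mono powr_mono2') auto
  finally have "K * \<delta> powr - (real d + p) \<le> K * (\<delta> powr - (real d + p - \<beta>) * r powr - \<beta>)"
    using K by (rule mult_left_mono)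
  also have "\<dots> = kernel d p \<delta> \<beta> r"
    using assms(2) unfolding kernel_def K_def[symmetric] powr_minus[of _ "real d + p - \<beta>"] by (simp add: divide_inverse mult_ac)
  finally show ?thesis
    by (simp add: K_def)
qed

text \<open>Below \<open>\<delta>\<close> the maximum is \<open>\<delta>\<close> and the minimum is
  \<open>r\<close>, so the weight is the kernel without its normalising factor; inverting that
  factor brings in \<open>1 / (d + p - \<beta>)\<close>.\<close>

lemma T_weight_near:
  assumes "0 < r" "r < \<delta>" "\<beta> < real d + p" "0 < d"
  shows "\<delta> powr (\<beta> - 2) / (max r \<delta> powr (real d + p - 2) * min r \<delta> powr \<beta>)
    = sphere_area d / (real d + p - \<beta>) * kernel d p \<delta> \<beta> r"
proof -
  have "\<delta> powr (\<beta> - 2) / \<delta> powr (real d + p - 2) = \<delta> powr - (real d + p - \<beta>)"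
    by (simp add: algebra_simps flip: powr_diff)
  then have "\<delta> powr (\<beta> - 2) / (\<delta> powr (real d + p - 2) * r powr \<beta>) = 1 / \<delta> powr (real d + p - \<beta>) * r powr - \<beta>"
    unfolding powr_minus divide_divide_eq_left[symmetric] by (simp add: divide_inverse)
  moreover have "sphere_area d / (real d + p - \<beta>) * ((real d + p - \<beta>) / sphere_area d / \<delta> powr (real d + p - \<beta>) * r powr - \<beta>)
      = 1 / \<delta> powr (real d + p - \<beta>) * r powr - \<beta>"
  proof -
    have cancel: "s / e * (e / s / X * Y) = 1 / X * Y" if "0 < s" "0 < e" for s e X Y :: real
      using that by simp
    show ?thesis
      using assms sphere_area_pos[of d] by (intro cancel) auto
  qed
  ultimately show ?thesis
    using assms by (simp add: kernel_def max_def min_def)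
qed

text \<open>The minimum is \<open>\<delta>\<close>, so \<open>\<delta> powr \<beta>\<close>
  cancels.\<close>

lemma T_weight_far:
  fixes \<delta> :: real
  assumes "0 < \<delta>" "\<delta> \<le> r"
  shows "\<delta> powr (\<beta> - 2) / (max r \<delta> powr e * min r \<delta> powr \<beta>) = \<delta> powr - 2 * (1 / r powr e)"
proof -
  have "\<delta> powr (\<beta> - 2) = \<delta> powr \<beta> * \<delta> powr - 2"
    by (simp flip: powr_add)
  then show ?thesis
    using assms by (simp add: max_def min_def)
qed

lemma nn_set_integral_pair_cmult:
  fixes F :: "'a::euclidean_space \<Rightarrow> 'a \<Rightarrow> ennreal"
  assumes F [measurable]: "(\<lambda>(x, y). F x y) \<in> borel_measurable (lborel \<Otimes>\<^sub>M lborel)" and [measurable]: "U \<in> sets borel"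
  shows "(\<integral>\<^sup>+x\<in>U. (\<integral>\<^sup>+y\<in>U. c * F x y \<partial>lborel) \<partial>lborel) = c * (\<integral>\<^sup>+x\<in>U. (\<integral>\<^sup>+y\<in>U. F x y \<partial>lborel) \<partial>lborel)"
proof -
  have [measurable]: "F x \<in> borel_measurable borel" for x
    using measurable_compose_Pair1[OF _ F, of x] by simp
  have [measurable]: "(\<lambda>x. \<integral>\<^sup>+y\<in>U. F x y \<partial>lborel) \<in> borel_measurable lborel"
    using F by measurable
  have "(\<integral>\<^sup>+y\<in>U. c * F x y \<partial>lborel) = c * (\<integral>\<^sup>+y\<in>U. F x y \<partial>lborel)" for x
    unfolding mult.assoc by (rule nn_integral_cmult) measurable
  then have "(\<integral>\<^sup>+x\<in>U. (\<integral>\<^sup>+y\<in>U. c * F x y \<partial>lborel) \<partial>lborel) = (\<integral>\<^sup>+x. c * ((\<integral>\<^sup>+y\<in>U. F x y \<partial>lborel) * indicator U x) \<partial>lborel)"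
    by (simp only: mult.assoc)
  also have "\<dots> = c * (\<integral>\<^sup>+x\<in>U. (\<integral>\<^sup>+y\<in>U. F x y \<partial>lborel) \<partial>lborel)"
    by (rule nn_integral_cmult) measurable
  finally show ?thesis .
qed

lemma near_energy_le_S_semi:
  fixes v :: "'a::euclidean_space \<Rightarrow> real"
  assumes [measurable]: "v \<in> borel_measurable borel" "U \<in> sets borel"
    and \<delta>: "0 < \<delta>" and \<beta>: "0 \<le> \<beta>" "\<beta> < real DIM('a) + p"
  shows "ennreal ((real DIM('a) + p - \<beta>) / sphere_area DIM('a) * \<delta> powr - (real DIM('a) + p)) * near_energy p \<delta> U v
    \<le> (\<integral>\<^sup>+x\<in>U. (\<integral>\<^sup>+y\<in>U. ennreal (kernel DIM('a) p \<delta> \<beta> (norm (y - x)) * \<bar>v y - v x\<bar> powr p) \<partial>lborel) \<partial>lborel)"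
proof -
  let ?c = "(real DIM('a) + p - \<beta>) / sphere_area DIM('a) * \<delta> powr - (real DIM('a) + p)"
  have c: "0 \<le> ?c"
    using \<beta> sphere_area_pos[of "DIM('a)"] by simp
  have "ennreal ?c * near_energy p \<delta> U v = (\<integral>\<^sup>+x\<in>U. (\<integral>\<^sup>+y\<in>U.
      ennreal ?c * (if norm (y - x) < \<delta> then ennreal (\<bar>v y - v x\<bar> powr p) else 0) \<partial>lborel) \<partial>lborel)"
    unfolding near_energy_def by (rule nn_set_integral_pair_cmult[symmetric]) measurable
  also have "\<dots> \<le> (\<integral>\<^sup>+x\<in>U. (\<integral>\<^sup>+y\<in>U. ennreal (kernel DIM('a) p \<delta> \<beta> (norm (y - x)) * \<bar>v y - v x\<bar> powr p) \<partial>lborel) \<partial>lborel)"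
  proof (intro nn_integral_mono mult_right_mono)
    fix x y :: 'a
    show "ennreal ?c * (if norm (y - x) < \<delta> then ennreal (\<bar>v y - v x\<bar> powr p) else 0)
      \<le> ennreal (kernel DIM('a) p \<delta> \<beta> (norm (y - x)) * \<bar>v y - v x\<bar> powr p)"
    \<comment> \<open>\<open>kernel_ge\<close> requires a positive distance; on the diagonal the
      increment is 0, and at distance \<open>\<delta>\<close> or more the left side is 0.\<close>
    proof (cases "x \<noteq> y \<and> norm (y - x) < \<delta>")
      case True
      then have "?c \<le> kernel DIM('a) p \<delta> \<beta> (norm (y - x))"
        using \<beta> by (intro kernel_ge) auto
      then have "?c * \<bar>v y - v x\<bar> powr p \<le> kernel DIM('a) p \<delta> \<beta> (norm (y - x)) * \<bar>v y - v x\<bar> powr p"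
        by (rule mult_right_mono) simp
      then have "ennreal (?c * \<bar>v y - v x\<bar> powr p) \<le> ennreal (kernel DIM('a) p \<delta> \<beta> (norm (y - x)) * \<bar>v y - v x\<bar> powr p)"
        by (rule ennreal_leI)
      then show ?thesis
        using True by (simp only: ennreal_mult'[OF c] if_True)
    qed auto
  qed auto
  finally show ?thesis .
qed

text \<open>Pairs closer than \<open>\<delta>\<close> carry exactly the kernel up to a constant, and
  enlarging \<open>V\<close> to \<open>U\<close> bounds them; the other pairs form
  \<open>far_energy\<close>.\<close>

lemma T_integral_le:
  fixes v :: "'a::euclidean_space \<Rightarrow> real"
  assumes [measurable]: "v \<in> borel_measurable borel" "V \<in> sets borel" "U \<in> sets borel" and VU: "V \<subseteq> U"
    and \<delta>: "0 < \<delta>" and \<beta>: "\<beta> < real DIM('a) + p"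
  shows "ennreal (\<delta> powr (\<beta> - 2)) * (\<integral>\<^sup>+x\<in>V. (\<integral>\<^sup>+y\<in>V. ennreal (\<bar>v y - v x\<bar> powr p /
        (max (norm (y - x)) \<delta> powr (real DIM('a) + p - 2) * min (norm (y - x)) \<delta> powr \<beta>)) \<partial>lborel) \<partial>lborel)
    \<le> ennreal (sphere_area DIM('a) / (real DIM('a) + p - \<beta>)) *
        (\<integral>\<^sup>+x\<in>U. (\<integral>\<^sup>+y\<in>U. ennreal (kernel DIM('a) p \<delta> \<beta> (norm (y - x)) * \<bar>v y - v x\<bar> powr p) \<partial>lborel) \<partial>lborel)
      + ennreal (\<delta> powr - 2) * far_energy p \<delta> V v"
proof -
  let ?e = "real DIM('a) + p - 2" and ?c = "sphere_area DIM('a) / (real DIM('a) + p - \<beta>)"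
  let ?w = "\<lambda>r. max r \<delta> powr ?e * min r \<delta> powr \<beta>"
  let ?k = "\<lambda>x y. ennreal (kernel DIM('a) p \<delta> \<beta> (norm (y - x)) * \<bar>v y - v x\<bar> powr p)"
  let ?t = "\<lambda>x y. ennreal (\<bar>v y - v x\<bar> powr p / ?w (norm (y - x)))"
  let ?f = "\<lambda>x y. if \<delta> \<le> norm (y - x) then ennreal (\<bar>v y - v x\<bar> powr p / norm (y - x) powr ?e) else 0"
  have c: "0 \<le> ?c"
    using \<beta> sphere_area_pos[of "DIM('a)"] by simp
  have pw: "ennreal (\<delta> powr (\<beta> - 2)) * ?t x y \<le> ennreal ?c * ?k x y + ennreal (\<delta> powr - 2) * ?f x y" for x y
  proof -
    let ?r = "norm (y - x)" and ?a = "\<bar>v y - v x\<bar> powr p"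
    have t: "ennreal (\<delta> powr (\<beta> - 2)) * ?t x y = ennreal (\<delta> powr (\<beta> - 2) / ?w ?r * ?a)"
      by (simp flip: ennreal_mult')
    consider "x = y" | "x \<noteq> y" "?r < \<delta>" | "\<delta> \<le> ?r"
      by linarith
    then show ?thesis
    proof cases
      case 2
      then have "\<delta> powr (\<beta> - 2) / ?w ?r = ?c * kernel DIM('a) p \<delta> \<beta> ?r"
        using \<beta> by (intro T_weight_near) auto
      then have "ennreal (\<delta> powr (\<beta> - 2)) * ?t x y = ennreal ?c * ?k x y"
        unfolding t using ennreal_mult'[OF c] by (simp only: mult.assoc)
      then show ?thesis
        by simp
    next
      case 3
      then have "\<delta> powr (\<beta> - 2) / ?w ?r = \<delta> powr - 2 * (1 / ?r powr ?e)"
        by (intro T_weight_far \<delta>)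
      then have "ennreal (\<delta> powr (\<beta> - 2)) * ?t x y = ennreal (\<delta> powr - 2 * (?a / ?r powr ?e))"
        unfolding t by simp
      also have "\<dots> = ennreal (\<delta> powr - 2) * ?f x y"
        using 3 by (simp only: ennreal_mult'[OF powr_ge_zero] if_True)
      finally show ?thesis
        by simp
    qed simp
  qed
  have "ennreal (\<delta> powr (\<beta> - 2)) * (\<integral>\<^sup>+x\<in>V. (\<integral>\<^sup>+y\<in>V. ?t x y \<partial>lborel) \<partial>lborel)
      = (\<integral>\<^sup>+x\<in>V. (\<integral>\<^sup>+y\<in>V. ennreal (\<delta> powr (\<beta> - 2)) * ?t x y \<partial>lborel) \<partial>lborel)"
    by (rule nn_set_integral_pair_cmult[symmetric]) measurable
  also have "\<dots> \<le> (\<integral>\<^sup>+x\<in>V. (\<integral>\<^sup>+y\<in>V. ennreal ?c * ?k x y + ennreal (\<delta> powr - 2) * ?f x y \<partial>lborel) \<partial>lborel)"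
    by (intro nn_integral_mono mult_right_mono pw) auto
  also have "\<dots> = (\<integral>\<^sup>+x. ennreal ?c * ((\<integral>\<^sup>+y\<in>V. ?k x y \<partial>lborel) * indicator V x)
      + ennreal (\<delta> powr - 2) * ((\<integral>\<^sup>+y\<in>V. ?f x y \<partial>lborel) * indicator V x) \<partial>lborel)"
  proof (rule nn_integral_cong)
    fix x
    have "(\<integral>\<^sup>+y\<in>V. ennreal ?c * ?k x y + ennreal (\<delta> powr - 2) * ?f x y \<partial>lborel)
        = (\<integral>\<^sup>+y. ennreal ?c * (?k x y * indicator V y) + ennreal (\<delta> powr - 2) * (?f x y * indicator V y) \<partial>lborel)"
      by (simp only: distrib_right mult.assoc)
    also have "\<dots> = ennreal ?c * (\<integral>\<^sup>+y\<in>V. ?k x y \<partial>lborel) + ennreal (\<delta> powr - 2) * (\<integral>\<^sup>+y\<in>V. ?f x y \<partial>lborel)"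
      by (subst nn_integral_add, measurable) (subst (1 2) nn_integral_cmult, auto)
    finally show "(\<integral>\<^sup>+y\<in>V. ennreal ?c * ?k x y + ennreal (\<delta> powr - 2) * ?f x y \<partial>lborel) * indicator V x
      = ennreal ?c * ((\<integral>\<^sup>+y\<in>V. ?k x y \<partial>lborel) * indicator V x)
      + ennreal (\<delta> powr - 2) * ((\<integral>\<^sup>+y\<in>V. ?f x y \<partial>lborel) * indicator V x)"
      by (simp only: distrib_right mult.assoc)
  qed
  also have "\<dots> = ennreal ?c * (\<integral>\<^sup>+x\<in>V. (\<integral>\<^sup>+y\<in>V. ?k x y \<partial>lborel) \<partial>lborel) + ennreal (\<delta> powr - 2) * far_energy p \<delta> V v"
    unfolding far_energy_def by (subst nn_integral_add, measurable) (subst (1 2) nn_integral_cmult, auto)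
  also have "\<dots> \<le> ennreal ?c * (\<integral>\<^sup>+x\<in>U. (\<integral>\<^sup>+y\<in>U. ?k x y \<partial>lborel) \<partial>lborel) + ennreal (\<delta> powr - 2) * far_energy p \<delta> V v"
    using VU by (intro add_right_mono mult_left_mono nn_integral_mono mult_mono) (auto simp: indicator_def)
  finally show ?thesis .
qed

section \<open>The trace estimates\<close>

definition strip_const :: "real \<Rightarrow> 'n::finite \<Rightarrow> real" where
  "strip_const p k = 4 * p * (2 / measure lborel (step_ball k)) powr (1 / p)"

lemma strip_const_nonneg: "1 < p \<Longrightarrow> 0 \<le> strip_const p k"
  by (simp add: strip_const_def)

text \<open>The unit-scale bounds are applied to \<open>w x = v (\<delta> *\<^sub>R x)\<close>, with
  \<open>v\<close> a Borel representative of \<open>u\<close>. The ratio \<open>s / e\<close> is the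
  inverse of the normalising constant of the kernel.\<close>

lemma strip_bounds:
  fixes u :: "real ^ 'n \<Rightarrow> real" and p \<delta> \<beta> :: real and k :: 'n
  defines "s \<equiv> sphere_area CARD('n)" and "e \<equiv> real CARD('n) + p - \<beta>"
  assumes p: "1 < p" and \<delta>: "0 < \<delta>" and \<beta>: "0 \<le> \<beta>" "0 < e"
    and u: "u \<in> borel_measurable (lebesgue_on (half_space k \<delta>))"
    and N: "0 \<le> N" "Lp_pow p (half_space k \<delta>) u = ennreal N"
    and S: "0 \<le> S" "S_semi_pow p \<delta> \<beta> (half_space k \<delta>) u = ennreal S"
  shows "Lp_pow p (strip k \<delta>) u \<le> ennreal (\<delta> * (strip_const p k * (N powr ((p - 1) / p) * (s / e * S) powr (1 / p))))"
    and "T_semi_pow p \<delta> \<beta> (strip k \<delta>) u \<le> ennreal ((1 + far_const p k) * (s / e * S))"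
proof -
  let ?d = "real CARD('n)" and ?A = "half_space k \<delta>" and ?V = "strip k \<delta>"
  have dim: "DIM(real ^ 'n) = CARD('n)"
    by simp
  have VA: "?V \<subseteq> ?A"
    by (auto simp: strip_def half_space_def)
  have s: "0 < s"
    by (simp add: s_def sphere_area_pos)
  have \<beta>': "\<beta> < ?d + p"
    using \<beta> by (simp add: e_def)
  obtain v where v[measurable]: "v \<in> borel_measurable borel" and ae: "AE x in lborel. x \<in> ?A \<longrightarrow> u x = v x"
    using lborel_borel_representative[OF sets_half_space u] by blast
  define w where "w x = v (\<delta> *\<^sub>R x)" for x
  have w[measurable]: "w \<in> borel_measurable borel"
    unfolding w_def by measurable
  let ?k = "\<lambda>x y. ennreal (kernel CARD('n) p \<delta> \<beta> (norm (y - x)) * \<bar>v y - v x\<bar> powr p)"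
  have S_v: "(\<integral>\<^sup>+x\<in>?A. (\<integral>\<^sup>+y\<in>?A. ?k x y \<partial>lborel) \<partial>lborel) = ennreal S"
    using S(2) nn_integral_pair_lebesgue_on[OF sets_half_space order_refl ae,
        of "\<lambda>x y a b. ennreal (kernel CARD('n) p \<delta> \<beta> (norm (y - x)) * \<bar>b - a\<bar> powr p)"]
    unfolding S_semi_pow_def dim by simp
  \<comment> \<open>\<open>near_energy_le_S_semi\<close> and \<open>near_energy_scaled\<close> put
    the power \<open>- (?d + p) + 2 * ?d = ?d - p\<close> of \<open>\<delta>\<close> in front of the
    energy of \<open>w\<close>; \<open>E\<close> is the bound after dividing by it and by
    \<open>e / s\<close>.\<close>
  define E where "E = \<delta> powr (p - ?d) * (s / e * S)"
  have E0: "0 \<le> E"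
    using S s \<beta> by (simp add: E_def)
  have E: "near_energy p 1 (half_space k 1) w \<le> ennreal E"
  proof -
    have "ennreal (e / s * \<delta> powr - (?d + p)) * near_energy p \<delta> ?A v \<le> ennreal S"
      using near_energy_le_S_semi[OF v sets_half_space \<delta> \<beta>(1), of p k \<delta>] \<beta>' S_v unfolding dim s_def e_def by simp
    moreover have "ennreal (e / s * \<delta> powr - (?d + p)) * near_energy p \<delta> ?A v
        = ennreal (e / s * \<delta> powr (?d - p)) * near_energy p 1 (half_space k 1) w"
    proof -
      have "\<delta> powr - (?d + p) * \<delta> powr (2 * ?d) = \<delta> powr (?d - p)"
        by (simp add: algebra_simps flip: powr_add)
      then have "ennreal (e / s * \<delta> powr - (?d + p)) * ennreal (\<delta> powr (2 * ?d)) = ennreal (e / s * \<delta> powr (?d - p))"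
        using s \<beta> by (subst ennreal_mult'[symmetric]) (auto simp: mult.assoc)
      then show ?thesis
        unfolding near_energy_scaled[OF v \<delta>] w_def by (simp add: mult.assoc[symmetric])
    qed
    ultimately have "ennreal (s / e * \<delta> powr (p - ?d)) * (ennreal (e / s * \<delta> powr (?d - p)) * near_energy p 1 (half_space k 1) w)
        \<le> ennreal (s / e * \<delta> powr (p - ?d)) * ennreal S"
      by (intro mult_left_mono) auto
    moreover have "ennreal (s / e * \<delta> powr (p - ?d)) * ennreal (e / s * \<delta> powr (?d - p)) = 1"
    proof -
      have "\<delta> powr (p - ?d) * \<delta> powr (?d - p) = 1"
        using \<delta> by (simp flip: powr_add)
      then have "(s / e * \<delta> powr (p - ?d)) * (e / s * \<delta> powr (?d - p)) = 1"
        using s \<beta> by (simp add: mult_ac)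
      then show ?thesis
        using s \<beta> by (subst ennreal_mult'[symmetric]) auto
    qed
    moreover have "ennreal (s / e * \<delta> powr (p - ?d)) * ennreal S = ennreal E"
      using s \<beta> by (subst ennreal_mult'[symmetric]) (auto simp: E_def mult_ac)
    ultimately show ?thesis
      by (simp add: mult.assoc[symmetric])
  qed
  have N_w: "(\<integral>\<^sup>+x\<in>half_space k 1. ennreal (\<bar>w x\<bar> powr p) \<partial>lborel) = ennreal (\<delta> powr - ?d * N)"
  proof -
    have "ennreal N = ennreal (\<delta> powr ?d) * (\<integral>\<^sup>+x\<in>half_space k 1. ennreal (\<bar>w x\<bar> powr p) \<partial>lborel)"
      using N(2) Lp_pow_representative[OF sets_half_space order_refl ae, of p] Lp_scaled(1)[OF v \<delta>, where k = k and p = p] by (simp add: w_def)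
    then have "ennreal (\<delta> powr - ?d * N) = ennreal (\<delta> powr - ?d * \<delta> powr ?d) * (\<integral>\<^sup>+x\<in>half_space k 1. ennreal (\<bar>w x\<bar> powr p) \<partial>lborel)"
      by (simp add: ennreal_mult' mult.assoc)
    also have "\<delta> powr - ?d * \<delta> powr ?d = 1"
      using \<delta> by (simp flip: powr_add)
    finally show ?thesis
      by simp
  qed
  have "Lp_pow p ?V u = ennreal (\<delta> powr ?d) * (\<integral>\<^sup>+x\<in>strip k 1. ennreal (\<bar>w x\<bar> powr p) \<partial>lborel)"
    using Lp_pow_representative[OF sets_strip VA ae, of p] Lp_scaled(2)[OF v \<delta>, where k = k and p = p] by (simp add: w_def)
  also have "\<dots> \<le> ennreal (\<delta> powr ?d) * ennreal (strip_const p k * ((\<delta> powr - ?d * N) powr ((p - 1) / p) * E powr (1 / p)))"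
    unfolding strip_const_def using N p E E0 by (intro mult_left_mono strip_Lp_le N_w) auto
  also have "\<dots> = ennreal (\<delta> powr ?d * (strip_const p k * ((\<delta> powr - ?d * N) powr ((p - 1) / p) * E powr (1 / p))))"
    by (subst ennreal_mult') auto
  also have "\<delta> powr ?d * (strip_const p k * ((\<delta> powr - ?d * N) powr ((p - 1) / p) * E powr (1 / p)))
      = \<delta> * (strip_const p k * (N powr ((p - 1) / p) * (s / e * S) powr (1 / p)))"
  proof -
    \<comment> \<open>The exponents from the change of variables, from \<open>N\<close> and from
      \<open>E\<close> add up to 1; this \<open>\<delta>\<close> balances the
      \<open>1 / \<delta>\<close> in the trace norm.\<close>
    have exponent: "?d + (- ?d * ((p - 1) / p) + (p - ?d) * (1 / p)) = 1"
      using p by (simp add: field_simps)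
    have \<delta>_eq: "\<delta> powr ?d * ((\<delta> powr - ?d) powr ((p - 1) / p) * (\<delta> powr (p - ?d)) powr (1 / p)) = \<delta>"
      unfolding powr_powr powr_add[symmetric] exponent using \<delta> by simp
    have "\<delta> powr ?d * (strip_const p k * ((\<delta> powr - ?d * N) powr ((p - 1) / p) * E powr (1 / p)))
        = (\<delta> powr ?d * ((\<delta> powr - ?d) powr ((p - 1) / p) * (\<delta> powr (p - ?d)) powr (1 / p)))
          * (strip_const p k * (N powr ((p - 1) / p) * (s / e * S) powr (1 / p)))"
      unfolding E_def powr_mult[of "\<delta> powr _"] by (simp only: mult_ac)
    then show ?thesis
      unfolding \<delta>_eq .
  qed
  finally show "Lp_pow p ?V u \<le> ennreal (\<delta> * (strip_const p k * (N powr ((p - 1) / p) * (s / e * S) powr (1 / p))))" .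

  have "T_semi_pow p \<delta> \<beta> ?V u \<le> ennreal (s / e) * ennreal S + ennreal (\<delta> powr - 2) * far_energy p \<delta> ?V v"
    using T_integral_le[OF v sets_strip sets_half_space VA \<delta>, of \<beta> p] \<beta>' S_v
      nn_integral_pair_lebesgue_on[OF sets_strip VA ae, of "\<lambda>x y a b. ennreal (\<bar>b - a\<bar> powr p /
        (max (norm (y - x)) \<delta> powr (?d + p - 2) * min (norm (y - x)) \<delta> powr \<beta>))"]
    unfolding T_semi_pow_def dim s_def e_def by simp
  \<comment> \<open>The powers \<open>- 2\<close>, \<open>?d - p + 2\<close> and
    \<open>p - ?d\<close> of \<open>\<delta>\<close> cancel, so no explicit power of
    \<open>\<delta>\<close> remains in the seminorm bound.\<close>
  also have "ennreal (\<delta> powr - 2) * far_energy p \<delta> ?V v \<le> ennreal (far_const p k * (s / e * S))"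
  proof -
    have "ennreal (\<delta> powr - 2) * far_energy p \<delta> ?V v = ennreal (\<delta> powr - 2) * (ennreal (\<delta> powr (?d - p + 2)) * far_energy p 1 (strip k 1) w)"
      unfolding far_energy_scaled[OF v \<delta>] w_def ..
    also have "\<dots> = ennreal (\<delta> powr - 2 * \<delta> powr (?d - p + 2)) * far_energy p 1 (strip k 1) w"
      by (simp only: ennreal_mult'[OF powr_ge_zero] mult.assoc)
    also have "\<dots> = ennreal (\<delta> powr (?d - p)) * far_energy p 1 (strip k 1) w"
      by (simp flip: powr_add)
    also have "\<dots> \<le> ennreal (\<delta> powr (?d - p)) * (ennreal (far_const p k) * ennreal E)"
      using p by (intro mult_left_mono order_trans[OF strip_far_energy_le] E w) auto
    also have "\<dots> = ennreal (\<delta> powr (?d - p) * (far_const p k * E))"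
      using far_const_nonneg[OF p, of k] by (simp add: ennreal_mult')
    also have "\<delta> powr (?d - p) * (far_const p k * E) = \<delta> powr (?d - p) * \<delta> powr (p - ?d) * (far_const p k * (s / e * S))"
      by (simp add: E_def mult_ac)
    also have "\<delta> powr (?d - p) * \<delta> powr (p - ?d) = 1"
      using \<delta> by (simp flip: powr_add)
    finally show ?thesis
      by simp
  qed
  also have "ennreal (s / e) * ennreal S + ennreal (far_const p k * (s / e * S)) = ennreal ((1 + far_const p k) * (s / e * S))"
  proof -
    have "ennreal (s / e) * ennreal S = ennreal (s / e * S)"
      using s \<beta> by (subst ennreal_mult') auto
    then show ?thesis
      using far_const_nonneg[OF p, of k] s \<beta> S by (simp add: distrib_right add_divide_distrib flip: ennreal_plus)
  qed
  finally show "T_semi_pow p \<delta> \<beta> ?V u \<le> ennreal ((1 + far_const p k) * (s / e * S))"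
    by (simp add: add_left_mono)
qed

section \<open>Real-valued estimates with a common constant\<close>

lemma powr_inverse_powr:
  fixes a p :: real
  assumes "0 \<le> a" "p \<noteq> 0"
  shows "(a powr (1 / p)) powr p = a" and "(a powr (1 / p)) powr (p - 1) = a powr ((p - 1) / p)"
  using assms by (simp_all add: powr_powr)

text \<open>Young's inequality with weights \<open>(p - 1) / p\<close> and \<open>1 / p\<close>,
  both at most 1. With the \<open>p\<close>-th powers of the norm and seminorm it gives the second
  inequality of the chain.\<close>

lemma powr_mult_powr_le_add:
  fixes a b p :: real
  assumes "1 < p" "0 \<le> a" "0 \<le> b"
  shows "a powr ((p - 1) / p) * b powr (1 / p) \<le> a + b"
proof (cases "a = 0 \<or> b = 0")
  case False
  then have "a powr ((p - 1) / p) * b powr (1 / p) \<le> (p - 1) / p * a + 1 / p * b"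
    using assms by (intro Youngs_inequality_0) (auto simp: field_simps)
  also have "\<dots> \<le> 1 * a + 1 * b"
    using assms by (intro add_mono mult_right_mono) auto
  finally show ?thesis
    by simp
qed (use assms in auto)

text \<open>The power of \<open>CARD('n) + p\<close> serves to replace the
  \<open>e powr (- 1 / p)\<close> of the norm estimate by a multiple of \<open>1 / e\<close>. Adding
  the constants of both estimates lets one number serve for both.\<close>

definition trace_const :: "real \<Rightarrow> 'n::finite \<Rightarrow> real" where
  "trace_const p k = strip_const p k * (sphere_area CARD('n) powr (1 / p) * (real CARD('n) + p) powr (1 - 1 / p))
     + (1 + far_const p k) * sphere_area CARD('n)"

lemma trace_const_pos:
  fixes k :: "'n::finite"
  assumes "1 < p"
  shows "0 < trace_const p k"
proof -
  have "0 < (1 + far_const p k) * sphere_area CARD('n)"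
    using far_const_nonneg[OF assms, of k] sphere_area_pos[of "CARD('n)"] by (intro mult_pos_pos) auto
  then show ?thesis
    using strip_const_nonneg[OF assms, of k] by (simp add: trace_const_def add_nonneg_pos)
qed

lemma strip_trace_estimates:
  fixes u :: "real ^ 'n \<Rightarrow> real" and p \<delta> \<beta> :: real and k :: 'n
  defines "e \<equiv> real CARD('n) + p - \<beta>"
  assumes p: "1 < p" and \<delta>: "0 < \<delta>" and \<beta>: "0 \<le> \<beta>" "0 < e"
    and u: "S_finite p \<delta> \<beta> (half_space k \<delta>) u"
  shows "u \<in> T_space p \<delta> \<beta> (strip k \<delta>)"
    and "1 / \<delta> * Lp_norm p (strip k \<delta>) u powr p
      \<le> trace_const p k / e * (Lp_norm p (half_space k \<delta>) u powr (p - 1) * S_semi p \<delta> \<beta> (half_space k \<delta>) u)"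
    and "Lp_norm p (half_space k \<delta>) u powr (p - 1) * S_semi p \<delta> \<beta> (half_space k \<delta>) u
      \<le> Lp_norm p (half_space k \<delta>) u powr p + S_semi p \<delta> \<beta> (half_space k \<delta>) u powr p"
    and "T_semi p \<delta> \<beta> (strip k \<delta>) u powr p \<le> trace_const p k / e * S_semi p \<delta> \<beta> (half_space k \<delta>) u powr p"
proof -
  let ?A = "half_space k \<delta>" and ?V = "strip k \<delta>" and ?d = "real CARD('n)"
  let ?s = "sphere_area CARD('n)"
  let ?C1 = "strip_const p k * (?s powr (1 / p) * (?d + p) powr (1 - 1 / p))"
  let ?C2 = "(1 + far_const p k) * ?s"
  define N where "N = enn2real (Lp_pow p ?A u)"
  define S where "S = enn2real (S_semi_pow p \<delta> \<beta> ?A u)"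
  have u': "u \<in> borel_measurable (lebesgue_on ?A)" "Lp_pow p ?A u = ennreal N" "S_semi_pow p \<delta> \<beta> ?A u = ennreal S"
    using u by (auto simp: S_finite_def N_def S_def)
  have NS: "0 \<le> N" "0 \<le> S"
    by (auto simp: N_def S_def)
  have s: "0 < ?s"
    by (simp add: sphere_area_pos)
  have C1: "0 \<le> ?C1" and C2: "0 \<le> ?C2"
    using strip_const_nonneg[OF p, of k] far_const_nonneg[OF p, of k] s by auto
  let ?L = "\<delta> * (strip_const p k * (N powr ((p - 1) / p) * (?s / e * S) powr (1 / p)))"
  let ?T = "(1 + far_const p k) * (?s / e * S)"
  note bounds = strip_bounds[OF p \<delta> \<beta>(1) _ u'(1) NS(1) u'(2) NS(2) u'(3), folded e_def, OF \<beta>(2)]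
  have L0: "0 \<le> ?L"
    using \<delta> strip_const_nonneg[OF p, of k] by simp
  have T0: "0 \<le> ?T"
    using far_const_nonneg[OF p, of k] s \<beta> NS by simp
  have "u \<in> borel_measurable (lebesgue_on ?V)"
    by (rule measurable_restrict_mono[OF u'(1)]) (auto simp: strip_def half_space_def)
  \<comment> \<open>Finiteness on the strip follows from the bounds by real numbers. It gives the
    real-valued norms their meaning, as \<open>enn2real\<close> sends infinity to 0.\<close>
  moreover have "Lp_pow p ?V u < \<infinity>" "T_semi_pow p \<delta> \<beta> ?V u < \<infinity>"
    using bounds by (auto intro: le_less_trans)
  ultimately show "u \<in> T_space p \<delta> \<beta> ?V"
    by (simp add: T_space_def)
  have norms: "Lp_norm p ?A u powr (p - 1) = N powr ((p - 1) / p)" "Lp_norm p ?A u powr p = N"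
      "S_semi p \<delta> \<beta> ?A u = S powr (1 / p)" "S_semi p \<delta> \<beta> ?A u powr p = S"
    using p NS by (simp_all only: Lp_norm_def S_semi_def N_def[symmetric] S_def[symmetric] powr_inverse_powr)
  show "Lp_norm p ?A u powr (p - 1) * S_semi p \<delta> \<beta> ?A u \<le> Lp_norm p ?A u powr p + S_semi p \<delta> \<beta> ?A u powr p"
    unfolding norms(1,2,4) unfolding norms(3) using p NS by (rule powr_mult_powr_le_add)
  have "Lp_norm p ?V u powr p = enn2real (Lp_pow p ?V u)"
    unfolding Lp_norm_def using p by (intro powr_inverse_powr) auto
  also have "\<dots> \<le> ?L"
    using L0 bounds(1) by (rule enn2real_leI)
  finally have "1 / \<delta> * Lp_norm p ?V u powr p \<le> strip_const p k * (N powr ((p - 1) / p) * (?s / e * S) powr (1 / p))"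
    using \<delta> by (simp add: field_simps)
  also have "(?s / e * S) powr (1 / p) = ?s powr (1 / p) * (1 / e) powr (1 / p) * S powr (1 / p)"
    by (simp flip: powr_mult)
  \<comment> \<open>As \<open>0 \<le> \<beta>\<close>, the number \<open>e\<close> is at most
    \<open>?d + p\<close>, which bounds \<open>e powr (1 - 1 / p)\<close> independently of
    \<open>\<beta>\<close>.\<close>
  also have "(1 / e) powr (1 / p) \<le> (?d + p) powr (1 - 1 / p) / e"
  proof -
    have "(1 / e) powr (1 / p) = e powr (1 - 1 / p) / e"
      using \<beta> by (simp add: powr_divide powr_diff)
    also have "\<dots> \<le> (?d + p) powr (1 - 1 / p) / e"
      using \<beta> p by (intro divide_right_mono powr_mono2) (auto simp: e_def)
    finally show ?thesis .
  qed
  also have "strip_const p k * (N powr ((p - 1) / p) * (?s powr (1 / p) * ((?d + p) powr (1 - 1 / p) / e) * S powr (1 / p)))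
      = ?C1 / e * (N powr ((p - 1) / p) * S powr (1 / p))"
    by simp
  also have "\<dots> \<le> trace_const p k / e * (N powr ((p - 1) / p) * S powr (1 / p))"
    unfolding trace_const_def using C2 \<beta> by (intro mult_right_mono divide_right_mono) auto
  finally show "1 / \<delta> * Lp_norm p ?V u powr p \<le> trace_const p k / e * (Lp_norm p ?A u powr (p - 1) * S_semi p \<delta> \<beta> ?A u)"
    unfolding norms(1,3) using strip_const_nonneg[OF p, of k] by (simp add: mult_left_mono mult_right_mono)
  have "T_semi p \<delta> \<beta> ?V u powr p = enn2real (T_semi_pow p \<delta> \<beta> ?V u)"
    unfolding T_semi_def using p by (intro powr_inverse_powr) auto
  also have "\<dots> \<le> ?T"
    using T0 bounds(2) by (rule enn2real_leI)
  also have "\<dots> = ?C2 / e * S"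
    by simp
  also have "\<dots> \<le> trace_const p k / e * S"
    unfolding trace_const_def using C1 \<beta> NS by (intro mult_right_mono divide_right_mono) auto
  finally show "T_semi p \<delta> \<beta> ?V u powr p \<le> trace_const p k / e * S_semi p \<delta> \<beta> ?A u powr p"
    unfolding norms(4) .
qed

text \<open>The constant precedes \<open>\<delta>\<close> and \<open>\<beta>\<close> in the
  quantifiers, which expresses its independence of them. Membership in \<open>T_space\<close>
  ensures that the real-valued quantities on the strip come from finite integrals.\<close>

theorem theorem1p1:
  fixes p :: real and k :: "'n::finite"
  assumes "1 < p"
  shows "\<exists>C>0. \<forall>\<delta> \<beta> :: real. 0 < \<delta> \<longrightarrow> 0 \<le> \<beta> \<longrightarrow> \<beta> < real CARD('n) + p \<longrightarrow>
    (\<forall>u \<in> S_space p \<delta> \<beta> (half_space k \<delta>).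
      u \<in> T_space p \<delta> \<beta> (strip k \<delta>) \<and>
      1 / \<delta> * Lp_norm p (strip k \<delta>) u powr p
        \<le> C * inverse \<bar>real CARD('n) + p - \<beta>\<bar> *
            (Lp_norm p (half_space k \<delta>) u powr (p - 1) * S_semi p \<delta> \<beta> (half_space k \<delta>) u) \<and>
      C * inverse \<bar>real CARD('n) + p - \<beta>\<bar> *
            (Lp_norm p (half_space k \<delta>) u powr (p - 1) * S_semi p \<delta> \<beta> (half_space k \<delta>) u)
        \<le> C * inverse \<bar>real CARD('n) + p - \<beta>\<bar> *
            (Lp_norm p (half_space k \<delta>) u powr p + S_semi p \<delta> \<beta> (half_space k \<delta>) u powr p) \<and>
      T_semi p \<delta> \<beta> (strip k \<delta>) u powr p
        \<le> C * inverse \<bar>real CARD('n) + p - \<beta>\<bar> * S_semi p \<delta> \<beta> (half_space k \<delta>) u powr p \<and>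
      T_norm p \<delta> \<beta> (strip k \<delta>) u
        \<le> C * \<bar>real CARD('n) + p - \<beta>\<bar> powr (- 1 / p) * S_norm p \<delta> \<beta> (half_space k \<delta>) u)"
proof -
  define C0 where "C0 = trace_const p k"
  \<comment> \<open>\<open>C0\<close> serves the estimates of \<open>p\<close>-th powers; the norm
    estimate takes a \<open>p\<close>-th root and leads to \<open>(2 * C0) powr (1 / p)\<close>. The
    sum dominates both.\<close>
  define C where "C = C0 + (2 * C0) powr (1 / p)"
  have C0: "0 < C0"
    unfolding C0_def by (rule trace_const_pos[OF assms])
  have C: "0 < C" "C0 \<le> C" "(2 * C0) powr (1 / p) \<le> C"
    using C0 by (auto simp: C_def intro: add_pos_nonneg)
  show ?thesis
  proof (intro exI[of _ C] conjI C(1) allI impI ballI)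
    fix \<delta> \<beta> :: real and u :: "real ^ 'n \<Rightarrow> real"
    assume \<delta>: "0 < \<delta>" and \<beta>: "0 \<le> \<beta>" "\<beta> < real CARD('n) + p"
      and u: "u \<in> S_space p \<delta> \<beta> (half_space k \<delta>)"
    define e where "e = real CARD('n) + p - \<beta>"
    define L where "L = 1 / \<delta> * Lp_norm p (strip k \<delta>) u powr p"
    define X where "X = Lp_norm p (half_space k \<delta>) u powr (p - 1) * S_semi p \<delta> \<beta> (half_space k \<delta>) u"
    define N where "N = Lp_norm p (half_space k \<delta>) u powr p"
    define S where "S = S_semi p \<delta> \<beta> (half_space k \<delta>) u powr p"
    define T where "T = T_semi p \<delta> \<beta> (strip k \<delta>) u powr p"
    have e: "0 < e"
      using \<beta> by (simp add: e_def)
    have nonneg: "0 \<le> X" "0 \<le> N" "0 \<le> S" "0 \<le> L" "0 \<le> T"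
      using \<delta> by (auto simp: X_def N_def S_def S_semi_def L_def T_def)
    have fin: "S_finite p \<delta> \<beta> (half_space k \<delta>) u"
      using u by (simp add: S_space_def)
    note est = strip_trace_estimates[OF assms \<delta> \<beta>(1) _ fin, folded e_def, OF e, folded C0_def, folded L_def X_def N_def S_def T_def]
    show "u \<in> T_space p \<delta> \<beta> (strip k \<delta>)"
      by (rule est(1))
    have "C0 / e \<le> C / e"
      using C(2) e by (simp add: divide_right_mono)
    then have "C0 / e * Z \<le> C * inverse \<bar>e\<bar> * Z" if "0 \<le> Z" for Z
      using mult_right_mono[OF _ that] e by (simp add: divide_inverse[symmetric] del: times_divide_eq_left)
    then show "L \<le> C * inverse \<bar>e\<bar> * X" "T \<le> C * inverse \<bar>e\<bar> * S"
      using est(2,4) nonneg order_trans by blast+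
    show "C * inverse \<bar>e\<bar> * X \<le> C * inverse \<bar>e\<bar> * (N + S)"
      using est(3) C(1) by (intro mult_left_mono) auto
    \<comment> \<open>Both terms are bounded by the same multiple of \<open>N + S\<close>, the
      \<open>p\<close>-th power of the norm on the half-space, hence the factor 2.\<close>
    have "L + T \<le> C0 / e * X + C0 / e * S"
      using est(2,4) by (rule add_mono)
    also have "\<dots> \<le> C0 / e * (N + S) + C0 / e * (N + S)"
      using est(3) nonneg C0 e by (intro add_mono mult_left_mono) auto
    also have "\<dots> = 2 * C0 * (1 / e) * (N + S)"
      by simp
    finally have "(L + T) powr (1 / p) \<le> (2 * C0 * (1 / e) * (N + S)) powr (1 / p)"
      using nonneg assms by (intro powr_mono2) auto
    also have "\<dots> = (2 * C0) powr (1 / p) * e powr (- 1 / p) * (N + S) powr (1 / p)"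
      using e by (simp only: powr_mult) (simp add: powr_divide powr_minus_divide)
    also have "\<dots> \<le> C * e powr (- 1 / p) * (N + S) powr (1 / p)"
      using C(3) by (intro mult_right_mono) auto
    finally show "T_norm p \<delta> \<beta> (strip k \<delta>) u \<le> C * \<bar>e\<bar> powr (- 1 / p) * S_norm p \<delta> \<beta> (half_space k \<delta>) u"
      using e by (simp add: T_norm_def S_norm_def L_def T_def N_def S_def)
  qed
qed

end
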